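(* For any $f\in\mathcal{H}$, one has \[ \widetilde{S(f)}=\tau\,\tilde f\,\tau \] as $\mathbb{Q}$-linear endomorphisms of $\mathcal{A}$ (the right-hand side being composition of maps).
   Context: $\mathcal{A}=\mathbb{Q}\langle x,y\rangle$ is the noncommutative polynomial algebra over $\mathbb{Q}$ in two indeterminates $x,y$. $\tau$ is the anti-automorphism of $\mathcal{A}$ with $\tau(x)=y$ and $\tau(y)=x$. For $u\in\mathcal{A}$, $L_u:\mathcal{A}\to\mathcal{A}$ is the $\mathbb{Q}$-linear map $L_u(w)=uw$; $L_y^{-1}:y\mathcal{A}\to\mathcal{A}$ is the inverse of $L_y:\mathcal{A}\to y\mathcal{A}$. Hopf algebra $\mathcal{H}$. A rooted tree is a finite (nonempty, non-planar) tree with a distinguished root; a forest is a finite commutative product $t_1\cdots t_n$ of rooted trees; $\mathbb{I}$ is the empty forest. $\mathcal{H}$ (Connes–Kreimer Hopf algebra) is the $\mathbb{Q}$-vector space with basis the forests, with commutative multiplication of forests and unit $\mathbb{I}$. The linear map $B_+:\mathcal{H}\to\mathcal{H}$ sends a forest to the rooted tree obtained by grafting all its roots onto a common new root; $B_+(\mathbb{I})=\bullet$ is the one-vertex tree. Every rooted tree is $B_+(f)$ for a unique forest $f$. The coproduct $\Delta$ is the algebra homomorphism ($\Delta(gh)=\Delta(g)\Delta(h)$, $\Delta(\mathbb{I})=\mathbb{I}\otimes\mathbb{I}$) with $\Delta(t)=\mathbb{I}\otimes t+(B_+\otimes\mathrm{id})(\Delta(f))$ for a tree $t=B_+(f)$.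 Sweedler notation: $\Delta(f)=\sum_{(f)}f'\otimes f''$. $S$ denotes the antipode of $\mathcal{H}$. Rooted tree maps. For $f\in\mathcal{H}$ the $\mathbb{Q}$-linear map $\tilde f:\mathcal{A}\to\mathcal{A}$ (linear in $f$) is defined recursively by: (1) $\tilde{\mathbb{I}}=\mathrm{id}$; (2) $\tilde{\bullet}(x)=yx$, $\tilde{\bullet}(y)=-yx$; (3) $\tilde t(u)=L_yL_{x+2y}L_y^{-1}\tilde f(u)$ if $t=B_+(f)$ is a tree with $f\neq\mathbb{I}$; (4) $\tilde f(u)=\tilde g(\tilde h(u))$ if $f=gh$; (5) $\tilde f(uw)=\sum_{(f)}\tilde{f'}(u)\tilde{f''}(w)$; where $w\in\mathcal{A}$, $u\in\{x,y\}$. It is known that this is well defined and that $f\mapsto\tilde f$ is an algebra homomorphism $\mathcal{H}\to\mathrm{End}(\mathcal{A})$. $\widetilde{S(f)}$ is the rooted tree map of $S(f)$. *)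

theory Defs
  imports Complex_Main "HOL-Library.Multiset" "HOL-Library.Poly_Mapping" "HOL-Library.Product_Plus"
begin

text \<open>
  All the \<open>\<rat>\<close>-algebras below are monoid algebras \<open>'k \<Rightarrow>\<^sub>0 rat\<close> of finitely supported functions on
  an additively written monoid \<open>'k\<close>; their multiplication is the convolution product of
  \<open>Poly_Mapping\<close>, and \<open>Poly_Mapping.single k 1\<close> is the basis vector \<open>k\<close>.
\<close>

section \<open>Linear algebra over the rationals\<close>

definition smul :: "rat \<Rightarrow> ('k \<Rightarrow>\<^sub>0 rat) \<Rightarrow> ('k \<Rightarrow>\<^sub>0 rat)" where
  "smul c p = Poly_Mapping.map ((*) c) p"

lemma lookup_smul [simp]: "Poly_Mapping.lookup (smul c p) k = c * Poly_Mapping.lookup p k"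
  by (auto simp: smul_def Poly_Mapping.map.rep_eq when_def)

lemma smul_conv_mult: "smul c p = Poly_Mapping.single 0 c * p"
  by (simp add: smul_def mult_map_scale_conv_mult)

lemma vector_space_smul: "vector_space smul"
  by (rule vector_space.intro)
     (auto intro!: poly_mapping_eqI simp: lookup_add algebra_simps)

abbreviation qlinear :: "(('k \<Rightarrow>\<^sub>0 rat) \<Rightarrow> ('l \<Rightarrow>\<^sub>0 rat)) \<Rightarrow> bool" where
  "qlinear \<equiv> Vector_Spaces.linear smul smul"

text \<open>The linear extension of a map defined on basis vectors.\<close>

definition lin_ext :: "('k \<Rightarrow> ('l \<Rightarrow>\<^sub>0 rat)) \<Rightarrow> ('k \<Rightarrow>\<^sub>0 rat) \<Rightarrow> ('l \<Rightarrow>\<^sub>0 rat)" where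
  "lin_ext g p = (\<Sum>k\<in>Poly_Mapping.keys p. smul (Poly_Mapping.lookup p k) (g k))"

lemma smul_zero_left [simp]: "smul 0 p = 0"
  by (rule poly_mapping_eqI) simp

lemma smul_one [simp]: "smul 1 p = p"
  by (rule poly_mapping_eqI) simp

lemma lin_ext_superset:
  "finite K \<Longrightarrow> Poly_Mapping.keys p \<subseteq> K \<Longrightarrow> lin_ext g p = (\<Sum>k\<in>K. smul (Poly_Mapping.lookup p k) (g k))"
  unfolding lin_ext_def by (rule sum.mono_neutral_left) (auto simp: in_keys_iff)

lemma lin_ext_single [simp]: "lin_ext g (Poly_Mapping.single k 1) = g k"
  by (simp add: lin_ext_def)

lemma lin_ext_add: "lin_ext g (p + q) = lin_ext g p + lin_ext g q"
proof -
  interpret vector_space smul by (rule vector_space_smul)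
  let ?K = "Poly_Mapping.keys p \<union> Poly_Mapping.keys q"
  have "lin_ext g (p + q) = (\<Sum>k\<in>?K. smul (Poly_Mapping.lookup (p + q) k) (g k))"
    by (rule lin_ext_superset) (auto simp: keys_add)
  moreover have "lin_ext g p = (\<Sum>k\<in>?K. smul (Poly_Mapping.lookup p k) (g k))"
    by (rule lin_ext_superset) auto
  moreover have "lin_ext g q = (\<Sum>k\<in>?K. smul (Poly_Mapping.lookup q k) (g k))"
    by (rule lin_ext_superset) auto
  ultimately show ?thesis
    by (simp add: lookup_add scale_left_distrib sum.distrib)
qed

lemma lin_ext_smul: "lin_ext g (smul c p) = smul c (lin_ext g p)"
proof -
  interpret vector_space smul by (rule vector_space_smul)
  have "lin_ext g (smul c p) = (\<Sum>k\<in>Poly_Mapping.keys p. smul (Poly_Mapping.lookup (smul c p) k) (g k))"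
    by (rule lin_ext_superset) (auto simp: in_keys_iff)
  then show ?thesis
    by (simp add: lin_ext_def scale_sum_right)
qed

lemma qlinear_lin_ext: "qlinear (lin_ext g)"
  unfolding Vector_Spaces.linear_iff
  by (simp add: vector_space_smul lin_ext_add lin_ext_smul)

lemma poly_mapping_eq_sum: "p = (\<Sum>k\<in>Poly_Mapping.keys p. Poly_Mapping.single k (Poly_Mapping.lookup p k))"
  by (rule poly_mapping_eqI) (auto simp: lookup_sum lookup_single when_def in_keys_iff)

lemma qlinear_eqI:
  assumes f: "qlinear f" and g: "qlinear g"
    and eq: "\<And>k. f (Poly_Mapping.single k 1) = g (Poly_Mapping.single k 1)"
  shows "f p = g p"
proof -
  interpret f: Vector_Spaces.linear smul smul f by (rule f)
  interpret g: Vector_Spaces.linear smul smul g by (rule g)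
  have single: "Poly_Mapping.single k c = smul c (Poly_Mapping.single k 1)" for k :: 'a and c
    by (rule poly_mapping_eqI) (simp add: lookup_single when_def)
  have "f (Poly_Mapping.single k c) = g (Poly_Mapping.single k c)" for k c
    by (subst (1 2) single) (simp add: f.scale g.scale eq)
  then have "f (\<Sum>k\<in>Poly_Mapping.keys p. Poly_Mapping.single k (Poly_Mapping.lookup p k)) =
             g (\<Sum>k\<in>Poly_Mapping.keys p. Poly_Mapping.single k (Poly_Mapping.lookup p k))"
    by (simp add: f.sum g.sum)
  then show ?thesis by (simp only: poly_mapping_eq_sum [symmetric])
qed

lemma single_zero_central: "a * Poly_Mapping.single 0 c = Poly_Mapping.single 0 c * a"
  for a :: "'k::monoid_add \<Rightarrow>\<^sub>0 rat"
proof -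
  have "(\<Sum>k\<in>Poly_Mapping.keys a. Poly_Mapping.single k (Poly_Mapping.lookup a k)) * Poly_Mapping.single 0 c =
    Poly_Mapping.single 0 c * (\<Sum>k\<in>Poly_Mapping.keys a. Poly_Mapping.single k (Poly_Mapping.lookup a k))"
    by (simp add: sum_distrib_left sum_distrib_right mult_single mult.commute)
  then show ?thesis by (simp only: poly_mapping_eq_sum [symmetric])
qed

lemma qlinear_mult_left: "qlinear (\<lambda>p. a * p)" for a :: "'k::monoid_add \<Rightarrow>\<^sub>0 rat"
proof -
  have "a * smul c p = smul c (a * p)" for c p
    by (metis smul_conv_mult single_zero_central mult.assoc)
  then show ?thesis
    unfolding Vector_Spaces.linear_iff by (simp add: vector_space_smul distrib_left)
qed

lemma qlinear_mult_right: "qlinear (\<lambda>p. p * a)" for a :: "'k::monoid_add \<Rightarrow>\<^sub>0 rat"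
  unfolding Vector_Spaces.linear_iff
  by (simp add: vector_space_smul smul_conv_mult distrib_right mult.assoc)

lemma qlinear_compose: "qlinear f \<Longrightarrow> qlinear g \<Longrightarrow> qlinear (\<lambda>p. f (g p))"
  by (simp add: Vector_Spaces.linear_iff)

lemma multiplicative_if_multiplicative_on_basis:
  fixes f :: "('k::monoid_add \<Rightarrow>\<^sub>0 rat) \<Rightarrow> ('l::monoid_add \<Rightarrow>\<^sub>0 rat)"
  assumes f: "qlinear f"
    and basis: "\<And>k l. f (Poly_Mapping.single (k + l) 1) =
                  f (Poly_Mapping.single k 1) * f (Poly_Mapping.single l 1)"
  shows "f (p * q) = f p * f q"
proof -
  have 1: "f (Poly_Mapping.single k 1 * q) = f (Poly_Mapping.single k 1) * f q" for k
    by (rule qlinear_eqI [where p = q and f = "\<lambda>q. f (Poly_Mapping.single k 1 * q)"])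
       (simp_all add: f qlinear_compose [OF f] qlinear_compose [OF qlinear_mult_left]
         qlinear_mult_left mult_single basis)
  show ?thesis
    by (rule qlinear_eqI [where p = p and f = "\<lambda>p. f (p * q)"])
       (simp_all add: f qlinear_compose [OF f] qlinear_compose [OF qlinear_mult_right f]
         qlinear_mult_right 1)
qed

lemma antimultiplicative_if_antimultiplicative_on_basis:
  fixes f :: "('k::monoid_add \<Rightarrow>\<^sub>0 rat) \<Rightarrow> ('l::monoid_add \<Rightarrow>\<^sub>0 rat)"
  assumes f: "qlinear f"
    and basis: "\<And>k l. f (Poly_Mapping.single (k + l) 1) =
                  f (Poly_Mapping.single l 1) * f (Poly_Mapping.single k 1)"
  shows "f (p * q) = f q * f p"
proof -
  have 1: "f (Poly_Mapping.single k 1 * q) = f q * f (Poly_Mapping.single k 1)" for k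
    by (rule qlinear_eqI [where p = q and f = "\<lambda>q. f (Poly_Mapping.single k 1 * q)"])
       (simp_all add: f qlinear_compose [OF f] qlinear_compose [OF qlinear_mult_right f]
         qlinear_mult_left mult_single basis)
  show ?thesis
    by (rule qlinear_eqI [where p = p and f = "\<lambda>p. f (p * q)"])
       (simp_all add: f qlinear_compose [OF f] qlinear_compose [OF qlinear_mult_left f]
         qlinear_mult_right 1)
qed


section \<open>The noncommutative polynomial algebra\<close>

text \<open>Lists form the free monoid; as \<open>Poly_Mapping\<close> expects, it is written additively.\<close>

instantiation list :: (type) monoid_add
begin
definition zero_list :: "'a list" where "zero_list = []"
definition plus_list :: "'a list \<Rightarrow> 'a list \<Rightarrow> 'a list" where "plus_list = (@)"
instance by standard (simp_all add: zero_list_def plus_list_def)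
end

datatype letter = LX | LY

type_synonym ncpoly = "letter list \<Rightarrow>\<^sub>0 rat"

definition X :: ncpoly where "X = Poly_Mapping.single [LX] 1"
definition Y :: ncpoly where "Y = Poly_Mapping.single [LY] 1"

fun swap_letter :: "letter \<Rightarrow> letter" where
  "swap_letter LX = LY"
| "swap_letter LY = LX"

definition tau :: "ncpoly \<Rightarrow> ncpoly" where
  "tau = lin_ext (\<lambda>w. Poly_Mapping.single (rev (map swap_letter w)) 1)"

lemma qlinear_tau: "qlinear tau"
  unfolding tau_def by (rule qlinear_lin_ext)

lemma tau_X: "tau X = Y" and tau_Y: "tau Y = X"
  by (simp_all add: tau_def X_def Y_def)

lemma tau_one: "tau 1 = 1"
proof -
  have "tau (Poly_Mapping.single [] 1) = Poly_Mapping.single [] 1"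
    unfolding tau_def by (subst lin_ext_single) simp
  then show ?thesis unfolding zero_list_def [symmetric] single_one .
qed

lemma tau_mult: "tau (p * q) = tau q * tau p"
  by (rule antimultiplicative_if_antimultiplicative_on_basis [OF qlinear_tau])
     (simp add: tau_def mult_single plus_list_def)

definition L :: "ncpoly \<Rightarrow> ncpoly \<Rightarrow> ncpoly" where
  "L u w = u * w"

text \<open>Only the values on \<open>range (L Y)\<close>, that is on \<open>y\<A>\<close>, are meaningful.\<close>

definition LY_inv :: "ncpoly \<Rightarrow> ncpoly" where
  "LY_inv = inv_into UNIV (L Y)"

lemma inj_L_Y: "inj (L Y)"
proof (rule injI)
  fix p q assume eq: "L Y p = L Y q"
  have key: "Poly_Mapping.lookup (Y * r) (LY # w) = Poly_Mapping.lookup r w" for r :: ncpoly and w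
    by (simp add: Y_def lookup_mult lookup_single when_mult plus_list_def)
  show "p = q"
    by (rule poly_mapping_eqI) (metis eq key L_def)
qed

lemma LY_inv_L_Y: "LY_inv (L Y w) = w"
  unfolding LY_inv_def by (rule inv_f_f [OF inj_L_Y])


section \<open>The Connes--Kreimer Hopf algebra\<close>

text \<open>A nonplanar rooted tree is its root together with the multiset of branches at the root; a
  forest, being a commutative product of trees, is a multiset of trees.\<close>

datatype rtree = Node "rtree multiset"

type_synonym forest = "rtree multiset"
type_synonym hopf = "forest \<Rightarrow>\<^sub>0 rat"

text \<open>\<open>H \<otimes> H\<close>, with the pair \<open>(F, G)\<close> standing for the basis vector \<open>F \<otimes> G\<close>.\<close>

type_synonym hopf2 = "(forest \<times> forest) \<Rightarrow>\<^sub>0 rat"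

abbreviation of_forest :: "forest \<Rightarrow> hopf" where
  "of_forest F \<equiv> Poly_Mapping.single F 1"

abbreviation of_forest2 :: "forest \<Rightarrow> forest \<Rightarrow> hopf2" where
  "of_forest2 F G \<equiv> Poly_Mapping.single (F, G) 1"

definition B_plus :: "hopf \<Rightarrow> hopf" where
  "B_plus = lin_ext (\<lambda>F. of_forest {#Node F#})"

text \<open>\<open>B\<^sub>+ \<otimes> id\<close>\<close>

definition B_plus_id :: "hopf2 \<Rightarrow> hopf2" where
  "B_plus_id = lin_ext (\<lambda>(F, G). of_forest2 {#Node F#} G)"

primrec coproduct_tree :: "rtree \<Rightarrow> hopf2" where
  "coproduct_tree (Node F) =
     of_forest2 {#} {#Node F#} + B_plus_id (\<Prod>\<^sub># (image_mset coproduct_tree F))"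

definition coproduct :: "hopf \<Rightarrow> hopf2" where
  "coproduct = lin_ext (\<lambda>F. \<Prod>\<^sub># (image_mset coproduct_tree F))"

lemma one_hopf: "(1 :: hopf) = of_forest {#}"
  by (simp flip: single_one)

lemma one_hopf2: "(1 :: hopf2) = of_forest2 {#} {#}"
  by (simp flip: single_one add: zero_prod_def)

lemma coproduct_one: "coproduct 1 = 1"
  unfolding one_hopf coproduct_def by (subst lin_ext_single) simp

lemma coproduct_mult: "coproduct (g * h) = coproduct g * coproduct h"
  by (rule multiplicative_if_multiplicative_on_basis)
     (simp_all add: coproduct_def qlinear_lin_ext)

lemma coproduct_B_plus:
  "coproduct (B_plus (of_forest F)) =
     of_forest2 {#} {#Node F#} + B_plus_id (coproduct (of_forest F))"
  by (simp add: coproduct_def B_plus_def)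

text \<open>\<open>sweedler b f\<close> is \<open>\<Sum>\<^bsub>(f)\<^esub> b(f', f'')\<close>, for bilinear \<open>b\<close>.\<close>

definition sweedler :: "(hopf \<Rightarrow> hopf \<Rightarrow> ('k \<Rightarrow>\<^sub>0 rat)) \<Rightarrow> hopf \<Rightarrow> ('k \<Rightarrow>\<^sub>0 rat)" where
  "sweedler b f = lin_ext (\<lambda>(F, G). b (of_forest F) (of_forest G)) (coproduct f)"

definition counit :: "hopf \<Rightarrow> rat" where
  "counit f = Poly_Mapping.lookup f {#}"

definition is_antipode :: "(hopf \<Rightarrow> hopf) \<Rightarrow> bool" where
  "is_antipode S \<longleftrightarrow> qlinear S \<and>
     (\<forall>f. sweedler (\<lambda>g h. S g * h) f = smul (counit f) 1) \<and>
     (\<forall>f. sweedler (\<lambda>g h. g * S h) f = smul (counit f) 1)"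

definition antipode :: "hopf \<Rightarrow> hopf" where
  "antipode = (THE S. is_antipode S)"


section \<open>Rooted tree maps\<close>

text \<open>The defining clauses of \<open>f \<mapsto> \<tilde>f\<close>. As in the usual definition, the clause for products is
  imposed only on the letters, and the Leibniz rule only for a letter as left factor.\<close>

definition is_rooted_tree_maps :: "(hopf \<Rightarrow> ncpoly \<Rightarrow> ncpoly) \<Rightarrow> bool" where
  "is_rooted_tree_maps R \<longleftrightarrow>
     (\<forall>f. qlinear (R f)) \<and>
     (\<forall>w. qlinear (\<lambda>f. R f w)) \<and>
     R 1 = id \<and>
     R (B_plus 1) X = Y * X \<and>
     R (B_plus 1) Y = - (Y * X) \<and>
     (\<forall>F. \<forall>u\<in>{X, Y}. F \<noteq> {#} \<longrightarrow>
        R (B_plus (of_forest F)) u = L Y (L (X + 2 * Y) (LY_inv (R (of_forest F) u)))) \<and>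
     (\<forall>g h. \<forall>u\<in>{X, Y}. R (g * h) u = R g (R h u)) \<and>
     (\<forall>f w. \<forall>u\<in>{X, Y}. R f (u * w) = sweedler (\<lambda>g h. R g u * R h w) f)"

definition rooted_tree_map :: "hopf \<Rightarrow> ncpoly \<Rightarrow> ncpoly" where
  "rooted_tree_map = (THE R. is_rooted_tree_maps R)"

end

theory Submission
  imports Defs
begin

text \<open>
  Put \<open>z = x + y\<close>. Rooted tree maps of positive degree kill \<open>z\<close>, so \<open>\<tilde>f\<close> is determined by
  \<open>\<tilde>f(y) = y P\<^sub>f\<close>, where \<open>P\<^sub>f\<close> is a combination of words in the blocks \<open>z\<^sup>k x\<close>. On these words
  \<open>f \<mapsto> P\<^sub>f\<close> is a Hopf algebra morphism to a quasi-shuffle algebra with deconcatenation, the one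
  sending \<open>B\<^sub>+\<close> to the cocycle of multiplication by \<open>x + 2 y\<close>. Since the quasi-shuffle product is
  commutative, this yields the existence of the rooted tree maps. Summing over deconcatenations of
  a single word one finds \<open>\<Sum> \<tilde>f' \<circ> (\<tau> \<tilde>f'' \<tau>) = \<epsilon>(f) id\<close>. As \<open>f \<mapsto> \<tilde>f\<close> is multiplicative, the
  rooted tree map of \<open>S(f)\<close> is the left convolution inverse of \<open>f \<mapsto> \<tilde>f\<close>, and the two inverses agree
  by coassociativity.
\<close>

section \<open>Linear algebra\<close>

text \<open>The one-vertex tree sends z to yx - yx = 0 and every further clause keeps z at 0, so z
  and y serve as generators instead of x and y. Then x + 2y = 2z - x, which on a word starting with
  z^k x either raises the first exponent or puts a new block x in front. The obstacle is that the
  clauses form one simultaneous recursion on forests and polynomials, whose consistency is not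
  visible. The operator of a single word, in contrast, can be written down without any condition to
  check. Moving such an operator past a block z^k x, with x = z - y, produces z^(j+k+1) x with sign
  -1. This is where the merging rule of the quasi-shuffle product comes from. As \<tau> reverses
  words, the conjugated map obeys a Leibniz rule read from the right, so it is not compared with the
  map of S(f) clause by clause. A convolution identity needs only the splittings of one
  word.\<close>

lemma qlinearI:
  assumes "\<And>p q. f (p + q) = f p + f q" and "\<And>c p. f (smul c p) = smul c (f p)"
  shows "qlinear f"
  unfolding Vector_Spaces.linear_iff using assms by (simp add: vector_space_smul)

lemma qlinear_add: "qlinear f \<Longrightarrow> f (p + q) = f p + f q"
  and qlinear_smul: "qlinear f \<Longrightarrow> f (smul c p) = smul c (f p)"
  by (simp_all add: Vector_Spaces.linear_iff)

lemma smul_add: "smul c (p + q) = smul c p + smul c q"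
  and smul_diff: "smul c (p - q) = smul c p - smul c q"
  and smul_minus: "smul c (- p) = - smul c p"
  and smul_zero [simp]: "smul c 0 = 0"
  and smul_smul: "smul c (smul d p) = smul (c * d) p"
  and add_smul: "smul (c + d) p = smul c p + smul d p"
  and smul_minus_one: "smul (- 1) p = - p"
  by (auto intro!: poly_mapping_eqI simp: lookup_add lookup_minus algebra_simps)

lemma smul_sum: "smul c (sum g K) = (\<Sum>k\<in>K. smul c (g k))"
  by (induction K rule: infinite_finite_induct) (simp_all add: smul_add)

lemma smul_mult_left: "smul c p * q = smul c (p * q)"
  and smul_mult_right: "p * smul c q = smul c (p * q)" for p q :: "'k::monoid_add \<Rightarrow>\<^sub>0 rat"
  using qlinear_smul [OF qlinear_mult_right] qlinear_smul [OF qlinear_mult_left] by metis+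

lemma qlinear_zero: "qlinear f \<Longrightarrow> f 0 = 0"
  using qlinear_smul [of f 0 0] by simp

lemma qlinear_uminus: "qlinear f \<Longrightarrow> f (- p) = - f p"
  using qlinear_smul [of f "- 1" p] by (simp add: smul_minus_one)

lemma qlinear_diff: "qlinear f \<Longrightarrow> f (p - q) = f p - f q"
  using qlinear_add [of f p "- q"] by (simp add: qlinear_uminus)

lemma qlinear_sum: "qlinear f \<Longrightarrow> f (sum g K) = (\<Sum>k\<in>K. f (g k))"
  by (induction K rule: infinite_finite_induct) (simp_all add: qlinear_add qlinear_zero)

lemma qlinear_lin_ext_apply: "qlinear h \<Longrightarrow> h (lin_ext g p) = lin_ext (\<lambda>k. h (g k)) p"
  by (simp add: lin_ext_def qlinear_sum qlinear_smul)

section \<open>Closure rules for the linearity of composite expressions\<close>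

named_theorems qlin

lemma qlinear_id' [qlin]: "qlinear (\<lambda>p. p)"
  by (rule qlinearI) simp_all

lemma qlinear_0 [qlin]: "qlinear (\<lambda>p. 0)"
  by (rule qlinearI) simp_all

lemma qlinear_plus' [qlin]: "qlinear f \<Longrightarrow> qlinear g \<Longrightarrow> qlinear (\<lambda>p. f p + g p)"
  by (rule qlinearI) (simp_all add: qlinear_add qlinear_smul smul_add)

lemma qlinear_minus' [qlin]: "qlinear f \<Longrightarrow> qlinear g \<Longrightarrow> qlinear (\<lambda>p. f p - g p)"
  by (rule qlinearI) (simp_all add: qlinear_add qlinear_smul smul_diff)

lemma qlinear_uminus' [qlin]: "qlinear f \<Longrightarrow> qlinear (\<lambda>p. - f p)"
  by (rule qlinearI) (simp_all add: qlinear_add qlinear_smul smul_minus)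

lemma qlinear_smul' [qlin]: "qlinear f \<Longrightarrow> qlinear (\<lambda>p. smul c (f p))"
  by (rule qlinearI) (simp_all add: qlinear_add qlinear_smul smul_add smul_smul mult.commute)

lemma qlinear_lookup [qlin]: "qlinear (\<lambda>p. smul (Poly_Mapping.lookup p k) q)"
  by (rule qlinearI) (simp_all add: lookup_add add_smul smul_smul)

lemma qlinear_mult_left' [qlin]: "qlinear f \<Longrightarrow> qlinear (\<lambda>p. a * f p)"
  and qlinear_mult_right' [qlin]: "qlinear f \<Longrightarrow> qlinear (\<lambda>p. f p * a)"
  for a :: "'k::monoid_add \<Rightarrow>\<^sub>0 rat"
  by (rule qlinear_compose [OF qlinear_mult_left] qlinear_compose [OF qlinear_mult_right]; assumption)+

lemma qlinear_lin_ext' [qlin]: "qlinear f \<Longrightarrow> qlinear (\<lambda>p. lin_ext g (f p))"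
  by (rule qlinear_compose [OF qlinear_lin_ext])

lemma qlinear_lin_ext_fun [qlin]:
  "(\<And>k. qlinear (\<lambda>p. g k p)) \<Longrightarrow> qlinear (\<lambda>p. lin_ext (\<lambda>k. g k p) q)"
  by (rule qlinearI)
    (simp_all add: lin_ext_def qlinear_add qlinear_smul smul_add sum.distrib smul_sum smul_smul mult.commute)

lemma qlinear_lin_ext_fun2 [qlin]:
  "(\<And>k l. qlinear (\<lambda>p. g k l p)) \<Longrightarrow> qlinear (\<lambda>p. lin_ext (\<lambda>(k, l). g k l p) q)"
  using qlinear_lin_ext_fun [of "\<lambda>(k, l). g k l"] by (simp add: case_prod_unfold)

lemma qlinear_tau' [qlin]: "qlinear f \<Longrightarrow> qlinear (\<lambda>p. tau (f p))"
  by (rule qlinear_compose [OF qlinear_tau])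

lemma lin_ext_basis [simp]: "lin_ext (\<lambda>k. Poly_Mapping.single k 1) p = p"
  by (rule qlinear_eqI [of "lin_ext (\<lambda>k. Poly_Mapping.single k 1)" "\<lambda>p. p"]) (simp_all add: qlin)

lemma lin_ext_fun_diff: "lin_ext (\<lambda>k. g k - h k) p = lin_ext g p - lin_ext h p"
  by (simp add: lin_ext_def smul_diff sum_subtractf)

lemma lin_ext_fun_mult_left: "lin_ext (\<lambda>k. a * g k) p = a * lin_ext g p"
  by (rule qlinear_lin_ext_apply [OF qlinear_mult_left, symmetric])

lemma lin_ext_fun_mult_right: "lin_ext (\<lambda>k. g k * a) p = lin_ext g p * a"
  by (rule qlinear_lin_ext_apply [OF qlinear_mult_right, symmetric])

lemma lin_ext_lin_ext: "lin_ext h (lin_ext g p) = lin_ext (\<lambda>k. lin_ext h (g k)) p"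
  by (rule qlinear_lin_ext_apply [OF qlinear_lin_ext])

lemmas lin_ext_linear =
  lin_ext_add lin_ext_smul qlinear_diff [OF qlinear_lin_ext] qlinear_uminus [OF qlinear_lin_ext]
  qlinear_zero [OF qlinear_lin_ext]

lemma lin_ext_cong: "(\<And>k. k \<in> Poly_Mapping.keys p \<Longrightarrow> g k = h k) \<Longrightarrow> lin_ext g p = lin_ext h p"
  by (simp add: lin_ext_def)

section \<open>Deconcatenation\<close>

text \<open>The Sweedler sum of the deconcatenation coproduct, kept as a functional of an arbitrary
  summand: iterated splittings are then nested sums, and no tensor product is needed here.\<close>

primrec decon_sum :: "nat list \<Rightarrow> (nat list \<Rightarrow> nat list \<Rightarrow> 'a::comm_monoid_add) \<Rightarrow> 'a" where
  "decon_sum [] b = b [] []"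
| "decon_sum (j # u) b = b [] (j # u) + decon_sum u (\<lambda>P. b (j # P))"

lemma decon_sum_cong:
  "(\<And>P Q. P @ Q = F \<Longrightarrow> b P Q = c P Q) \<Longrightarrow> decon_sum F b = decon_sum F c"
proof (induction F arbitrary: b c)
  case (Cons j F)
  have "decon_sum F (\<lambda>P. b (j # P)) = decon_sum F (\<lambda>P. c (j # P))"
    by (rule Cons.IH) (simp add: Cons.prems)
  then show ?case by (simp add: Cons.prems)
qed simp

lemma decon_sum_add: "decon_sum F (\<lambda>P Q. b P Q + c P Q) = decon_sum F b + decon_sum F c"
  by (induction F arbitrary: b c) (simp_all add: algebra_simps)

lemma decon_sum_diff: "decon_sum F (\<lambda>P Q. b P Q - c P Q) = decon_sum F b - decon_sum F c" for b :: "_ \<Rightarrow> _ \<Rightarrow> 'a::ab_group_add"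
  by (induction F arbitrary: b c) (simp_all add: algebra_simps)

lemma decon_sum_hom:
  assumes "\<And>p q. f (p + q) = f p + f q"
  shows "f (decon_sum F b) = decon_sum F (\<lambda>P Q. f (b P Q))"
  by (induction F arbitrary: b) (simp_all add: assms)

lemma decon_sum_mult_left: "decon_sum F (\<lambda>P Q. a * b P Q) = a * decon_sum F b" for a :: "'a::semiring_0"
  by (rule decon_sum_hom [symmetric]) (rule distrib_left)

lemma decon_sum_mult_right: "decon_sum F (\<lambda>P Q. b P Q * a) = decon_sum F b * a" for a :: "'a::semiring_0"
  by (rule decon_sum_hom [where f = "\<lambda>p. p * a", symmetric]) (rule distrib_right)

text \<open>Both sides run over the splittings of \<open>F\<close> into three consecutive
  pieces.\<close>

lemma decon_sum_coassoc:
  "decon_sum F (\<lambda>P Q. decon_sum P (\<lambda>A B. c A B Q)) = decon_sum F (\<lambda>P Q. decon_sum Q (c P))"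
  by (induction F arbitrary: c) (simp_all add: decon_sum_add algebra_simps)

lemma decon_sum_zero [simp]: "decon_sum F (\<lambda>P Q. 0) = 0"
  by (induction F) simp_all

lemma decon_sum_counit_left [simp]: "decon_sum F (\<lambda>P Q. if P = [] then b P Q else 0) = b [] F"
  by (cases F) simp_all

lemma decon_sum_counit_right [simp]: "decon_sum F (\<lambda>P Q. if Q = [] then b P Q else 0) = b F []"
  by (induction F arbitrary: b) simp_all

lemma decon_sum_snoc: "decon_sum (F @ [k]) b = decon_sum F (\<lambda>P Q. b P (Q @ [k])) + b (F @ [k]) []"
  by (induction F arbitrary: b) (simp_all add: algebra_simps)

lemma qlinear_decon_sum [qlin]:
  "(\<And>P Q. qlinear (\<lambda>p. b P Q p)) \<Longrightarrow> qlinear (\<lambda>p. decon_sum F (\<lambda>P Q. b P Q p))"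
  by (induction F arbitrary: b) (simp_all add: qlin)

section \<open>The action of words on noncommutative polynomials\<close>

definition Z :: ncpoly where "Z = X + Y"

text \<open>
  The word \<open>[k\<^sub>1, \<dots>, k\<^sub>r]\<close> stands for the polynomial \<open>z\<^bsup>k\<^sub>1\<^esup> x \<cdots> z\<^bsup>k\<^sub>r\<^esup> x\<close> with \<open>z = x + y\<close>.
\<close>

definition block :: "nat \<Rightarrow> ncpoly" where "block j = Z ^ j * X"

primrec theta_w :: "nat list \<Rightarrow> ncpoly" where
  "theta_w [] = 1"
| "theta_w (j # u) = block j * theta_w u"

lemma theta_w_append: "theta_w (u @ v) = theta_w u * theta_w v"
  by (induction u) (simp_all add: mult.assoc)

text \<open>
  The endomorphism attached to a word is forced by \<open>z \<mapsto> 0\<close> and \<open>y \<mapsto> y P\<close> on letters (for a nonempty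
  word \<open>P\<close>) together with the Leibniz rule for deconcatenation; the case of \<open>x = z - y\<close> follows.
\<close>

primrec act_w :: "letter list \<Rightarrow> nat list \<Rightarrow> ncpoly" where
  "act_w [] P = (if P = [] then 1 else 0)"
| "act_w (l # w) P = (case l of
      LX \<Rightarrow> Z * act_w w P - Y * decon_sum P (\<lambda>A B. theta_w A * act_w w B)
    | LY \<Rightarrow> Y * decon_sum P (\<lambda>A B. theta_w A * act_w w B))"

definition act :: "nat list \<Rightarrow> ncpoly \<Rightarrow> ncpoly" where
  "act P = lin_ext (\<lambda>w. act_w w P)"

text \<open>This is \<open>act P\<close> conjugated by left multiplication by \<open>Y\<close> (see
  \<open>act_Y\<close>). The recursions below close only on the pair \<open>act\<close>,
  \<open>tact\<close>.\<close>

definition tact :: "nat list \<Rightarrow> ncpoly \<Rightarrow> ncpoly" where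
  "tact P w = decon_sum P (\<lambda>A B. theta_w A * act B w)"

lemma qlinear_act [qlin]: "qlinear f \<Longrightarrow> qlinear (\<lambda>w. act P (f w))"
  by (simp add: act_def qlin)

lemma qlinear_tact [qlin]: "qlinear f \<Longrightarrow> qlinear (\<lambda>w. tact P (f w))"
  by (simp add: tact_def qlin)

lemma X_eq: "X = Z - Y" by (simp add: Z_def)

text \<open>As \<open>X = Z - Y\<close>, the elements \<open>Y\<close> and \<open>Z\<close> generate
  the algebra. Induction along them is convenient because \<open>Z\<close> commutes with every
  \<open>act P\<close>, while \<open>X\<close> has no such simple rule.\<close>

lemma ncpoly_induct [case_names 1 Y Z diff smul]:
  assumes one: "P 1"
    and Y: "\<And>v. P v \<Longrightarrow> P (Y * v)"
    and Z: "\<And>v. P v \<Longrightarrow> P (Z * v)"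
    and diff: "\<And>p q. P p \<Longrightarrow> P q \<Longrightarrow> P (p - q)"
    and smul: "\<And>c p. P p \<Longrightarrow> P (smul c p)"
  shows "P p"
proof -
  have basis: "P (Poly_Mapping.single w 1)" for w :: "letter list"
  proof (induction w)
    case Nil
    then show ?case using one by (simp flip: single_one add: zero_list_def)
  next
    case (Cons l w)
    have Yw: "Poly_Mapping.single (LY # w) 1 = Y * Poly_Mapping.single w 1"
      and Xw: "Poly_Mapping.single (LX # w) 1 = Z * Poly_Mapping.single w 1 - Y * Poly_Mapping.single w 1"
      by (simp_all add: Z_def Y_def X_def mult_single plus_list_def algebra_simps)
    show ?case
      by (cases l) (simp_all add: Yw Xw Y Z diff Cons)
  qed
  have zero: "P 0" using diff [OF one one] by simp
  have add: "P (p + q)" if "P p" "P q" for p q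
    using diff [OF that(1) diff [OF zero that(2)]] by simp
  have "P (\<Sum>k\<in>K. smul (c k) (Poly_Mapping.single k 1))" for K and c :: "letter list \<Rightarrow> rat"
    by (induction K rule: infinite_finite_induct) (simp_all add: zero add smul basis)
  from this [of "Poly_Mapping.lookup p" "Poly_Mapping.keys p"] show ?thesis
    by (simp flip: lin_ext_def)
qed

lemma qlinear_eqI_YZ:
  assumes f: "qlinear f" and g: "qlinear g"
    and one: "f 1 = g 1"
    and Y: "\<And>v. f v = g v \<Longrightarrow> f (Y * v) = g (Y * v)"
    and Z: "\<And>v. f v = g v \<Longrightarrow> f (Z * v) = g (Z * v)"
  shows "f p = g p"
  by (induction p rule: ncpoly_induct)
    (simp_all add: one Y Z qlinear_diff [OF f] qlinear_diff [OF g] qlinear_smul [OF f] qlinear_smul [OF g])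

lemma act_one: "act P 1 = (if P = [] then 1 else 0)"
proof -
  have "act P (Poly_Mapping.single [] 1) = (if P = [] then 1 else 0)"
    by (simp add: act_def)
  then show ?thesis by (simp flip: single_one add: zero_list_def)
qed

lemma act_Y: "act P (Y * w) = Y * tact P w"
  by (rule qlinear_eqI [where p = w and f = "\<lambda>w. act P (Y * w)"])
     (simp_all add: qlin, simp add: act_def tact_def Y_def mult_single plus_list_def)

lemma act_Z: "act P (Z * w) = Z * act P w"
proof (rule qlinear_eqI [where p = w and f = "\<lambda>w. act P (Z * w)"])
  fix k
  have "act P (X * Poly_Mapping.single k 1) =
      Z * act P (Poly_Mapping.single k 1) - Y * tact P (Poly_Mapping.single k 1)"
    by (simp add: act_def tact_def X_def mult_single plus_list_def)
  then show "act P (Z * Poly_Mapping.single k 1) = Z * act P (Poly_Mapping.single k 1)"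
    by (simp add: Z_def distrib_right qlinear_add [OF qlinear_act [OF qlinear_id']] act_Y)
qed (simp_all add: qlin)

lemmas act_linear =
  qlinear_add [OF qlinear_act [OF qlinear_id']] qlinear_smul [OF qlinear_act [OF qlinear_id']]
  qlinear_diff [OF qlinear_act [OF qlinear_id']] qlinear_uminus [OF qlinear_act [OF qlinear_id']]
  qlinear_zero [OF qlinear_act [OF qlinear_id']]

lemmas tact_linear =
  qlinear_add [OF qlinear_tact [OF qlinear_id']] qlinear_smul [OF qlinear_tact [OF qlinear_id']]
  qlinear_diff [OF qlinear_tact [OF qlinear_id']] qlinear_uminus [OF qlinear_tact [OF qlinear_id']]
  qlinear_zero [OF qlinear_tact [OF qlinear_id']]

lemma act_X: "act P (X * w) = Z * act P w - Y * tact P w"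
  by (simp add: X_eq left_diff_distrib act_linear act_Y act_Z)

lemma act_Z_power: "act P (Z ^ k * w) = Z ^ k * act P w"
  by (induction k) (simp_all add: act_Z mult.assoc)

lemma tact_Nil': "tact [] w = act [] w"
  by (simp add: tact_def)

lemma act_Nil [simp]: "act [] w = w"
  by (rule qlinear_eqI_YZ [where p = w and f = "act []"]) (simp_all add: qlin act_one act_Y act_Z tact_Nil')

lemma tact_Nil [simp]: "tact [] w = w"
  by (simp add: tact_def)

text \<open>The splitting with empty prefix yields \<open>act\<close>; every other prefix starts
  with \<open>j\<close>.\<close>

lemma tact_Cons: "tact (j # u) w = act (j # u) w + block j * tact u w"
  by (simp add: tact_def decon_sum_mult_left [symmetric] mult.assoc)

lemma tact_one: "tact P 1 = theta_w P"
proof -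
  have "tact P 1 = decon_sum P (\<lambda>A B. if B = [] then theta_w A else 0)"
    unfolding tact_def by (rule decon_sum_cong) (simp add: act_one)
  then show ?thesis by simp
qed

text \<open>\<open>Z ^ k\<close> passes through and \<open>X\<close> acts as \<open>Z - Y\<close>.
  Eliminating \<open>act\<close> in favour of \<open>tact\<close> leaves the stray term
  \<open>Z ^ k * Z * block j\<close>, which is the merged block of index \<open>j + k + 1\<close>,
  with a minus sign.\<close>

lemma act_Cons_block:
  "act (j # u) (block k * w) = block k * tact (j # u) w - block (Suc (j + k)) * tact u w"
proof -
  have "Z ^ k * Z * Z ^ j = Z ^ Suc (k + j)"
    by (simp add: power_add power_commutes mult.assoc)
  then have block: "Z ^ k * (Z * (block j * tact u w)) = block (Suc (j + k)) * tact u w"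
    unfolding block_def by (metis mult.assoc add.commute)
  have "act (j # u) (block k * w) = Z ^ k * (Z * (tact (j # u) w - block j * tact u w) - Y * tact (j # u) w)"
    by (simp add: block_def mult.assoc act_Z_power act_X tact_Cons)
  also have "\<dots> = Z ^ k * ((Z - Y) * tact (j # u) w) - Z ^ k * (Z * (block j * tact u w))"
    by (simp add: right_diff_distrib left_diff_distrib)
  finally show ?thesis unfolding block by (simp add: block_def X_eq mult.assoc)
qed

text \<open>The Leibniz rule, built in for letters, spreads to any left factor. For a factor
  \<open>Y\<close>, the prefix absorbed by \<open>theta_w\<close> and the splitting of the rest are
  regrouped by coassociativity.\<close>

lemma act_mult: "act P (v * w) = decon_sum P (\<lambda>A B. act A v * act B w)"
proof -
  have "\<forall>P. act P (v * w) = decon_sum P (\<lambda>A B. act A v * act B w)"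
  proof (induction v rule: ncpoly_induct)
    case 1
    show ?case
    proof
      fix P
      have "decon_sum P (\<lambda>A B. act A 1 * act B w) = decon_sum P (\<lambda>A B. if A = [] then act B w else 0)"
        by (rule decon_sum_cong) (simp add: act_one)
      then show "act P (1 * w) = decon_sum P (\<lambda>A B. act A 1 * act B w)" by simp
    qed
  next
    case (Y v)
    show ?case
    proof
      fix P
      have "act P (Y * v * w) = Y * decon_sum P (\<lambda>A B. theta_w A * decon_sum B (\<lambda>C D. act C v * act D w))"
        by (simp add: mult.assoc act_Y tact_def Y)
      also have "\<dots> = decon_sum P (\<lambda>A B. decon_sum B (\<lambda>C D. Y * theta_w A * act C v * act D w))"
        by (simp add: mult.assoc flip: decon_sum_mult_left)
      also have "\<dots> = decon_sum P (\<lambda>A B. act A (Y * v) * act B w)"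
        by (simp add: mult.assoc act_Y tact_def flip: decon_sum_mult_left decon_sum_mult_right decon_sum_coassoc)
      finally show "act P (Y * v * w) = decon_sum P (\<lambda>A B. act A (Y * v) * act B w)" .
    qed
  next
    case (Z v)
    then show ?case by (simp add: mult.assoc act_Z decon_sum_mult_left)
  next
    case (diff p q)
    then show ?case by (simp add: left_diff_distrib act_linear decon_sum_diff)
  next
    case (smul c p)
    then show ?case by (simp add: smul_mult_left act_linear decon_sum_hom [of "smul c"] smul_add)
  qed
  then show ?thesis by blast
qed

section \<open>The quasi-shuffle algebra\<close>

type_synonym qsh = "nat list \<Rightarrow>\<^sub>0 rat"

abbreviation bas :: "'k \<Rightarrow> ('k \<Rightarrow>\<^sub>0 rat)" where
  "bas w \<equiv> Poly_Mapping.single w 1"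

definition prepend :: "nat \<Rightarrow> qsh \<Rightarrow> qsh" where
  "prepend j = lin_ext (\<lambda>u. bas (j # u))"

lemma prepend_bas [simp]: "prepend j (bas u) = bas (j # u)"
  by (simp add: prepend_def)

lemma qlinear_prepend [qlin]: "qlinear f \<Longrightarrow> qlinear (\<lambda>p. prepend j (f p))"
  by (simp add: prepend_def qlin)

lemmas prepend_linear =
  qlinear_add [OF qlinear_prepend [OF qlinear_id']] qlinear_smul [OF qlinear_prepend [OF qlinear_id']]
  qlinear_diff [OF qlinear_prepend [OF qlinear_id']]

text \<open>A quasi-shuffle product: the letters \<open>j\<close> and \<open>k\<close> merge to
  minus the letter \<open>j + k + 1\<close>, as dictated by \<open>act_Cons_block\<close>. This
  merging is commutative and associative.\<close>

fun qs_w :: "nat list \<Rightarrow> nat list \<Rightarrow> qsh" where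
  "qs_w [] v = bas v"
| "qs_w (j # u) [] = bas (j # u)"
| "qs_w (j # u) (k # v) =
     prepend j (qs_w u (k # v)) + prepend k (qs_w (j # u) v) - prepend (Suc (j + k)) (qs_w u v)"

lemma qs_w_Nil_right [simp]: "qs_w u [] = bas u"
  by (cases u) simp_all

lemma qs_w_commute: "qs_w u v = qs_w v u"
  by (induction u v rule: qs_w.induct) (simp_all add: add.commute)

definition qs :: "qsh \<Rightarrow> qsh \<Rightarrow> qsh" where
  "qs p q = lin_ext (\<lambda>u. lin_ext (qs_w u) q) p"

lemma qs_bas [simp]: "qs (bas u) (bas v) = qs_w u v"
  by (simp add: qs_def)

lemma qlinear_qs [qlin]: "qlinear f \<Longrightarrow> qlinear (\<lambda>p. qs q (f p))"
  "qlinear f \<Longrightarrow> qlinear (\<lambda>p. qs (f p) q)"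
  by (simp_all add: qs_def qlin)

lemmas qs_linear =
  qlinear_add [OF qlinear_qs(1) [OF qlinear_id']] qlinear_diff [OF qlinear_qs(1) [OF qlinear_id']]
  qlinear_add [OF qlinear_qs(2) [OF qlinear_id']] qlinear_diff [OF qlinear_qs(2) [OF qlinear_id']]

lemma qs_one_left [simp]: "qs (bas []) p = p"
proof -
  have "qs_w [] = (\<lambda>v. bas v)" by (rule ext) simp
  then show ?thesis by (simp add: qs_def)
qed

lemma qs_commute: "qs p q = qs q p"
proof (rule qlinear_eqI [where p = p and f = "\<lambda>p. qs p q"])
  show "qs (bas u) q = qs q (bas u)" for u
    by (rule qlinear_eqI [where p = q and f = "qs (bas u)"]) (simp_all add: qlin, rule qs_w_commute)
qed (simp_all add: qlin)

lemma qs_prepend: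
  "qs (prepend j p) (prepend k q) = prepend j (qs p (prepend k q)) + prepend k (qs (prepend j p) q) - prepend (Suc (j + k)) (qs p q)"
proof (rule qlinear_eqI [where p = p and f = "\<lambda>p. qs (prepend j p) (prepend k q)"])
  show "qs (prepend j (bas u)) (prepend k q) =
      prepend j (qs (bas u) (prepend k q)) + prepend k (qs (prepend j (bas u)) q) - prepend (Suc (j + k)) (qs (bas u) q)" for u
    by (rule qlinear_eqI [where p = q and f = "\<lambda>q. qs (prepend j (bas u)) (prepend k q)"]) (simp_all add: qlin)
qed (simp_all add: qlin)

text \<open>The induction step of associativity. The seven hypotheses correspond to the nonempty
  sets of first letters that can be removed. Both sides expand into seven terms according to which
  first letters merge; merging all three gives \<open>a + b + c + 2\<close> with sign plus.\<close>

lemma qs_assoc_prepend: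
  fixes p q r :: qsh and a b c :: nat
  defines "F \<equiv> prepend a p" and "G \<equiv> prepend b q" and "H \<equiv> prepend c r"
  assumes
    "qs (qs p G) H = qs p (qs G H)" "qs (qs F q) H = qs F (qs q H)" "qs (qs F G) r = qs F (qs G r)"
    "qs (qs p q) H = qs p (qs q H)" "qs (qs p G) r = qs p (qs G r)" "qs (qs F q) r = qs F (qs q r)"
    "qs (qs p q) r = qs p (qs q r)"
  shows "qs (qs F G) H = qs F (qs G H)"
proof -
  have FG: "qs F G = prepend a (qs p G) + prepend b (qs F q) - prepend (Suc (a + b)) (qs p q)"
    and GH: "qs G H = prepend b (qs q H) + prepend c (qs G r) - prepend (Suc (b + c)) (qs q r)"
    unfolding F_def G_def H_def by (rule qs_prepend)+
  have L: "qs (prepend k s) H = prepend k (qs s H) + prepend c (qs (prepend k s) r) - prepend (Suc (k + c)) (qs s r)" for k s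
    unfolding H_def by (rule qs_prepend)
  have R: "qs F (prepend k s) = prepend a (qs p (prepend k s)) + prepend k (qs F s) - prepend (Suc (a + k)) (qs p s)" for k s
    unfolding F_def by (rule qs_prepend)
  have "qs (qs F G) H = prepend a (qs (qs p G) H) + prepend b (qs (qs F q) H) - prepend (Suc (a + b)) (qs (qs p q) H)
      + prepend c (qs (qs F G) r) - prepend (Suc (a + c)) (qs (qs p G) r) - prepend (Suc (b + c)) (qs (qs F q) r)
      + prepend (Suc (Suc (a + b + c))) (qs (qs p q) r)"
    by (simp add: FG qs_linear L prepend_linear algebra_simps)
  moreover have "qs F (qs G H) = prepend a (qs p (qs G H)) + prepend b (qs F (qs q H)) - prepend (Suc (a + b)) (qs p (qs q H))
      + prepend c (qs F (qs G r)) - prepend (Suc (a + c)) (qs p (qs G r)) - prepend (Suc (b + c)) (qs F (qs q r))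
      + prepend (Suc (Suc (a + b + c))) (qs p (qs q r))"
    by (simp add: GH qs_linear R prepend_linear algebra_simps)
  ultimately show ?thesis using assms by simp
qed

lemma qs_w_assoc: "qs (qs_w u v) (bas w) = qs (bas u) (qs_w v w)"
proof (induction "length u + length v + length w" arbitrary: u v w rule: less_induct)
  case less
  show ?case
  proof (cases "u = [] \<or> v = [] \<or> w = []")
    case True
    then show ?thesis by (metis qs_bas qs_one_left qs_w.simps(1) qs_w_Nil_right qs_commute)
  next
    case False
    then obtain a u' b v' c w' where [simp]: "u = a # u'" "v = b # v'" "w = c # w'"
      by (meson neq_Nil_conv)
    show ?thesis
      using qs_assoc_prepend [where a = a and p = "bas u'" and b = b and q = "bas v'" and c = c and r = "bas w'"]
      by (simp add: less del: qs_w.simps)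
  qed
qed

lemma qs_assoc: "qs (qs p q) r = qs p (qs q r)"
proof (rule qlinear_eqI [where p = p and f = "\<lambda>p. qs (qs p q) r"])
  fix u
  show "qs (qs (bas u) q) r = qs (bas u) (qs q r)"
  proof (rule qlinear_eqI [where p = q and f = "\<lambda>q. qs (qs (bas u) q) r"])
    show "qs (qs (bas u) (bas v)) r = qs (bas u) (qs (bas v) r)" for v
      by (rule qlinear_eqI [where p = r and f = "qs (qs (bas u) (bas v))"]) (simp_all add: qlin qs_w_assoc)
  qed (simp_all add: qlin)
qed (simp_all add: qlin)

global_interpretation qsh: comm_monoid_mset qs "bas []"
  defines qprod = qsh.F
proof
  show "qs p (bas []) = p" for p by (subst qs_commute) simp
qed (fact qs_assoc qs_commute)+

section \<open>The action of the quasi-shuffle algebra\<close>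

definition theta :: "qsh \<Rightarrow> ncpoly" where
  "theta = lin_ext theta_w"

definition Act :: "qsh \<Rightarrow> ncpoly \<Rightarrow> ncpoly" where
  "Act p w = lin_ext (\<lambda>P. act P w) p"

definition Tact :: "qsh \<Rightarrow> ncpoly \<Rightarrow> ncpoly" where
  "Tact p w = lin_ext (\<lambda>P. tact P w) p"

lemma Act_bas [simp]: "Act (bas P) w = act P w" and Tact_bas [simp]: "Tact (bas P) w = tact P w"
  by (simp_all add: Act_def Tact_def)

lemma qlinear_theta [qlin]: "qlinear f \<Longrightarrow> qlinear (\<lambda>p. theta (f p))"
  by (simp add: theta_def qlin)

lemma qlinear_Act [qlin]: "qlinear f \<Longrightarrow> qlinear (\<lambda>k. Act (f k) w)"
  "qlinear g \<Longrightarrow> qlinear (\<lambda>k. Act p (g k))"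
  by (simp_all add: Act_def qlin)

lemma qlinear_Tact [qlin]: "qlinear f \<Longrightarrow> qlinear (\<lambda>k. Tact (f k) w)"
  "qlinear g \<Longrightarrow> qlinear (\<lambda>k. Tact p (g k))"
  by (simp_all add: Tact_def qlin)

lemmas Act_linear =
  qlinear_add [OF qlinear_Act(1) [OF qlinear_id']] qlinear_diff [OF qlinear_Act(1) [OF qlinear_id']]

lemmas Tact_linear =
  qlinear_add [OF qlinear_Tact(1) [OF qlinear_id']] qlinear_diff [OF qlinear_Tact(1) [OF qlinear_id']]

lemma Act_Y: "Act p (Y * w) = Y * Tact p w"
  by (simp add: Act_def Tact_def act_Y lin_ext_fun_mult_left)

lemma Act_Z: "Act p (Z * w) = Z * Act p w"
  by (simp add: Act_def act_Z lin_ext_fun_mult_left)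

lemma lin_ext_delta: "lin_ext (\<lambda>k. if k = l then g k else 0) p = smul (Poly_Mapping.lookup p l) (g l)"
  by (rule qlinear_eqI [where p = p and f = "lin_ext (\<lambda>k. if k = l then g k else 0)"])
    (simp_all add: qlin lookup_single when_def)

lemma Act_one: "Act p 1 = smul (Poly_Mapping.lookup p []) 1"
  by (simp add: Act_def act_one lin_ext_delta [where g = "\<lambda>_. 1"])

lemma Tact_one: "Tact p 1 = theta p"
  by (simp add: Tact_def theta_def tact_one)

lemma Tact_prepend: "Tact (prepend j p) w = Act (prepend j p) w + block j * Tact p w"
  by (rule qlinear_eqI [where p = p and f = "\<lambda>p. Tact (prepend j p) w"]) (simp_all add: qlin tact_Cons)

text \<open>
  The recursion of the quasi-shuffle product is exactly the one obtained by moving \<^term>\<open>act P\<close> past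
  the first block of \<^term>\<open>tact Q w\<close>, which is why composition of the operators is quasi-shuffling.
\<close>

lemma Act_Tact_qs_w:
  "Act (qs_w P Q) w = act P (act Q w) \<and> Tact (qs_w P Q) w = tact P (tact Q w)"
proof (induction P Q arbitrary: w rule: qs_w.induct)
  case (3 j u k v)
  let ?F = "j # u" and ?G = "k # v"
  have step: "tact ?F (tact ?G w) - act ?F (act ?G w) =
      block j * tact u (tact ?G w) + block k * tact ?F (tact v w) - block (Suc (j + k)) * tact u (tact v w)" for w
  proof -
    have "tact ?F (tact ?G w) = act ?F (tact ?G w) + block j * tact u (tact ?G w)"
      by (rule tact_Cons)
    also have "act ?F (tact ?G w) = act ?F (act ?G w) + act ?F (block k * tact v w)"
      by (simp add: tact_Cons act_linear)
    also have "act ?F (block k * tact v w) = block k * tact ?F (tact v w) - block (Suc (j + k)) * tact u (tact v w)"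
      by (rule act_Cons_block)
    finally show ?thesis by simp
  qed
  have step': "Tact (qs_w ?F ?G) w - Act (qs_w ?F ?G) w =
      block j * tact u (tact ?G w) + block k * tact ?F (tact v w) - block (Suc (j + k)) * tact u (tact v w)" for w
    using 3 by (simp add: Act_linear Tact_linear Tact_prepend)
  \<comment> \<open>By \<open>step\<close> and \<open>step'\<close> the two sides have the same
    difference between \<open>tact\<close> and \<open>act\<close>, so at each \<open>w\<close> the
    claim for \<open>act\<close> yields the one for \<open>tact\<close>. The induction on
    \<open>w\<close> needs exactly this, since \<open>Y\<close> turns \<open>act\<close> into
    \<open>tact\<close>.\<close>
  have tact: "Tact (qs_w ?F ?G) w = tact ?F (tact ?G w)"
    if "Act (qs_w ?F ?G) w = act ?F (act ?G w)" for w
    using step [of w] step' [of w] that by (metis diff_add_cancel)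
  have "Act (qs_w ?F ?G) w = act ?F (act ?G w)"
  proof (rule qlinear_eqI_YZ [where p = w and f = "Act (qs_w ?F ?G)"])
    \<comment> \<open>At \<open>1\<close> both sides vanish: every word in the product has a first
      letter, so there is no constant term.\<close>
    have "Poly_Mapping.lookup (prepend i p) [] = 0" for i p
    proof -
      have "smul (Poly_Mapping.lookup (prepend i p) []) 1 = (0 :: ncpoly)"
        by (rule qlinear_eqI [where p = p and f = "\<lambda>p. smul (Poly_Mapping.lookup (prepend i p) []) 1"])
          (simp_all add: qlin lookup_single qlinear_compose [OF qlinear_lookup qlinear_prepend])
      from arg_cong [OF this, of "\<lambda>p. Poly_Mapping.lookup p 0"] show ?thesis
        by (simp add: lookup_one)
    qed
    then show "Act (qs_w ?F ?G) 1 = act ?F (act ?G 1)"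
      by (simp add: Act_one act_one lookup_add lookup_minus act_linear)
  next
    fix v assume "Act (qs_w ?F ?G) v = act ?F (act ?G v)"
    then show "Act (qs_w ?F ?G) (Y * v) = act ?F (act ?G (Y * v))"
      "Act (qs_w ?F ?G) (Z * v) = act ?F (act ?G (Z * v))"
      by (simp_all only: Act_Y Act_Z act_Y act_Z tact)
  qed (simp_all add: qlin del: qs_w.simps)
  then show ?case using tact by blast
qed simp_all

lemma Act_qs: "Act (qs p q) w = Act p (Act q w)"
proof (rule qlinear_eqI [where p = p and f = "\<lambda>p. Act (qs p q) w"])
  show "Act (qs (bas u) q) w = Act (bas u) (Act q w)" for u
    by (rule qlinear_eqI [where p = q and f = "\<lambda>q. Act (qs (bas u) q) w"])
      (simp_all add: qlin Act_Tact_qs_w)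
qed (simp_all add: qlin)

section \<open>Deconcatenation is multiplicative\<close>

type_synonym qsh2 = "(nat list \<times> nat list) \<Rightarrow>\<^sub>0 rat"

lemma qlinear_eqI_prod:
  assumes "qlinear f" and "qlinear g"
    and "\<And>k l. f (bas (k, l)) = g (bas (k, l))"
  shows "f p = g p"
  by (rule qlinear_eqI [OF assms(1,2)]) (metis assms(3) surj_pair)

definition ten :: "('k \<Rightarrow>\<^sub>0 rat) \<Rightarrow> ('l \<Rightarrow>\<^sub>0 rat) \<Rightarrow> (('k \<times> 'l) \<Rightarrow>\<^sub>0 rat)" where
  "ten p q = lin_ext (\<lambda>u. lin_ext (\<lambda>v. bas (u, v)) q) p"

lemma ten_bas [simp]: "ten (bas u) (bas v) = bas (u, v)"
  by (simp add: ten_def)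

lemma qlinear_ten [qlin]: "qlinear f \<Longrightarrow> qlinear (\<lambda>p. ten q (f p))"
  "qlinear f \<Longrightarrow> qlinear (\<lambda>p. ten (f p) r)"
  by (simp_all add: ten_def qlin)

lemmas ten_linear =
  qlinear_add [OF qlinear_ten(1) [OF qlinear_id']] qlinear_add [OF qlinear_ten(2) [OF qlinear_id']]
  qlinear_diff [OF qlinear_ten(1) [OF qlinear_id']] qlinear_diff [OF qlinear_ten(2) [OF qlinear_id']]
  qlinear_smul [OF qlinear_ten(1) [OF qlinear_id']] qlinear_smul [OF qlinear_ten(2) [OF qlinear_id']]
  qlinear_uminus [OF qlinear_ten(1) [OF qlinear_id']] qlinear_uminus [OF qlinear_ten(2) [OF qlinear_id']]

lemma lin_ext_ten: "lin_ext (case_prod b) (ten p q) = lin_ext (\<lambda>u. lin_ext (b u) q) p"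
  by (simp add: ten_def lin_ext_lin_ext)

definition prepend1 :: "nat \<Rightarrow> qsh2 \<Rightarrow> qsh2" where
  "prepend1 j = lin_ext (\<lambda>(u, v). bas (j # u, v))"

definition qs2 :: "qsh2 \<Rightarrow> qsh2 \<Rightarrow> qsh2" where
  "qs2 x y = lin_ext (\<lambda>(a, b). lin_ext (\<lambda>(c, d). ten (qs_w a c) (qs_w b d)) y) x"

definition decon_w :: "nat list \<Rightarrow> qsh2" where
  "decon_w F = decon_sum F (\<lambda>A B. bas (A, B))"

definition decon :: "qsh \<Rightarrow> qsh2" where
  "decon = lin_ext decon_w"

lemma prepend1_bas [simp]: "prepend1 j (bas (u, v)) = bas (j # u, v)"
  and qs2_bas [simp]: "qs2 (bas (a, b)) (bas (c, d)) = ten (qs_w a c) (qs_w b d)"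
  and decon_bas [simp]: "decon (bas u) = decon_w u"
  by (simp_all add: prepend1_def qs2_def decon_def)

lemma qlinear_prepend1 [qlin]: "qlinear f \<Longrightarrow> qlinear (\<lambda>p. prepend1 j (f p))"
  by (simp add: prepend1_def qlin)

lemma qlinear_qs2 [qlin]: "qlinear f \<Longrightarrow> qlinear (\<lambda>p. qs2 x (f p))"
  "qlinear f \<Longrightarrow> qlinear (\<lambda>p. qs2 (f p) y)"
  by (simp_all add: qs2_def qlin)

lemma qlinear_decon [qlin]: "qlinear f \<Longrightarrow> qlinear (\<lambda>p. decon (f p))"
  by (simp add: decon_def qlin)

lemmas prepend1_linear =
  qlinear_add [OF qlinear_prepend1 [OF qlinear_id']] qlinear_diff [OF qlinear_prepend1 [OF qlinear_id']]

lemmas qs2_linear =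
  qlinear_add [OF qlinear_qs2(1) [OF qlinear_id']] qlinear_add [OF qlinear_qs2(2) [OF qlinear_id']]

lemmas decon_linear =
  qlinear_add [OF qlinear_decon [OF qlinear_id']] qlinear_diff [OF qlinear_decon [OF qlinear_id']]
  qlinear_smul [OF qlinear_decon [OF qlinear_id']] qlinear_uminus [OF qlinear_decon [OF qlinear_id']]

lemma prepend1_ten: "prepend1 j (ten p q) = ten (prepend j p) q"
proof (rule qlinear_eqI [where p = p and f = "\<lambda>p. prepend1 j (ten p q)"])
  show "prepend1 j (ten (bas u) q) = ten (prepend j (bas u)) q" for u
    by (rule qlinear_eqI [where p = q and f = "\<lambda>q. prepend1 j (ten (bas u) q)"]) (simp_all add: qlin)
qed (simp_all add: qlin)

lemma qs2_one_left [simp]: "qs2 (bas ([], [])) y = y"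
  by (rule qlinear_eqI_prod [where p = y and f = "qs2 (bas ([], []))"]) (simp_all add: qlin)

lemma qs2_commute: "qs2 x y = qs2 y x"
proof (rule qlinear_eqI_prod [where p = x and f = "\<lambda>x. qs2 x y"])
  show "qs2 (bas (k, l)) y = qs2 y (bas (k, l))" for k l
    by (rule qlinear_eqI_prod [where p = y and f = "qs2 (bas (k, l))"])
      (simp_all add: qlin, metis qs_w_commute)
qed (simp_all add: qlin)

lemma qs2_ten_bas: "qs2 (bas (a, b)) (ten r s) = ten (qs (bas a) r) (qs (bas b) s)"
proof (rule qlinear_eqI [where p = r and f = "\<lambda>r. qs2 (bas (a, b)) (ten r s)"])
  show "qs2 (bas (a, b)) (ten (bas c) s) = ten (qs (bas a) (bas c)) (qs (bas b) s)" for c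
    by (rule qlinear_eqI [where p = s and f = "\<lambda>s. qs2 (bas (a, b)) (ten (bas c) s)"]) (simp_all add: qlin)
qed (simp_all add: qlin)

lemma qs2_ten: "qs2 (ten p q) (ten r s) = ten (qs p r) (qs q s)"
proof (rule qlinear_eqI [where p = p and f = "\<lambda>p. qs2 (ten p q) (ten r s)"])
  show "qs2 (ten (bas a) q) (ten r s) = ten (qs (bas a) r) (qs q s)" for a
    by (rule qlinear_eqI [where p = q and f = "\<lambda>q. qs2 (ten (bas a) q) (ten r s)"])
      (simp_all add: qlin qs2_ten_bas)
qed (simp_all add: qlin)

lemma qs2_prepend1:
  "qs2 (prepend1 j x) (prepend1 k y) =
     prepend1 j (qs2 x (prepend1 k y)) + prepend1 k (qs2 (prepend1 j x) y) - prepend1 (Suc (j + k)) (qs2 x y)"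
proof (rule qlinear_eqI_prod [where p = x and f = "\<lambda>x. qs2 (prepend1 j x) (prepend1 k y)"])
  fix a b
  show "qs2 (prepend1 j (bas (a, b))) (prepend1 k y) =
     prepend1 j (qs2 (bas (a, b)) (prepend1 k y)) + prepend1 k (qs2 (prepend1 j (bas (a, b))) y) -
     prepend1 (Suc (j + k)) (qs2 (bas (a, b)) y)"
    by (rule qlinear_eqI_prod [where p = y and f = "\<lambda>y. qs2 (prepend1 j (bas (a, b))) (prepend1 k y)"])
      (simp_all add: qlin prepend1_ten ten_linear)
qed (simp_all add: qlin)

lemma qs2_one_prepend1: "qs2 (bas ([], b)) (prepend1 k y) = prepend1 k (qs2 (bas ([], b)) y)"
  by (rule qlinear_eqI_prod [where p = y and f = "\<lambda>y. qs2 (bas ([], b)) (prepend1 k y)"])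
    (simp_all add: qlin prepend1_ten)

lemma decon_w_Nil [simp]: "decon_w [] = bas ([], [])"
  by (simp add: decon_w_def)

lemma decon_w_Cons: "decon_w (j # u) = bas ([], j # u) + prepend1 j (decon_w u)"
  by (simp add: decon_w_def decon_sum_hom [of "prepend1 j"] prepend1_linear)

lemma decon_prepend: "decon (prepend j p) = ten (bas []) (prepend j p) + prepend1 j (decon p)"
  by (rule qlinear_eqI [where p = p and f = "\<lambda>p. decon (prepend j p)"]) (simp_all add: qlin decon_w_Cons)

text \<open>Splittings with empty first part contribute \<open>1 \<otimes> PQ\<close>. In all others
  the left component has a first letter, and \<open>qs2_prepend1\<close> reproduces the recursion of
  \<open>qs_w\<close> there.\<close>

lemma decon_qs_w: "decon (qs_w P Q) = qs2 (decon_w P) (decon_w Q)"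
proof (induction P Q rule: qs_w.induct)
  case (1 v)
  then show ?case by simp
next
  case (2 j u)
  then show ?case by (subst qs2_commute) simp
next
  case (3 j u k v)
  let ?F = "j # u" and ?G = "k # v"
  have "qs2 (decon_w ?F) (decon_w ?G) = qs2 (bas ([], ?F)) (bas ([], ?G)) + qs2 (bas ([], ?F)) (prepend1 k (decon_w v))
      + qs2 (prepend1 j (decon_w u)) (bas ([], ?G)) + qs2 (prepend1 j (decon_w u)) (prepend1 k (decon_w v))"
    by (simp add: decon_w_Cons qs2_linear algebra_simps del: qs2_bas)
  also have "qs2 (bas ([], ?F)) (prepend1 k (decon_w v)) = prepend1 k (qs2 (bas ([], ?F)) (decon_w v))"
    by (rule qs2_one_prepend1)
  also have "qs2 (prepend1 j (decon_w u)) (bas ([], ?G)) = prepend1 j (qs2 (decon_w u) (bas ([], ?G)))"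
    by (metis qs2_one_prepend1 qs2_commute)
  also have "qs2 (prepend1 j (decon_w u)) (prepend1 k (decon_w v)) = prepend1 j (qs2 (decon_w u) (prepend1 k (decon_w v)))
      + prepend1 k (qs2 (prepend1 j (decon_w u)) (decon_w v)) - prepend1 (Suc (j + k)) (qs2 (decon_w u) (decon_w v))"
    by (rule qs2_prepend1)
  also have "qs2 (bas ([], ?F)) (bas ([], ?G)) = ten (bas []) (qs_w ?F ?G)"
    by simp
  finally have "qs2 (decon_w ?F) (decon_w ?G) = ten (bas []) (qs_w ?F ?G)
      + prepend1 j (qs2 (decon_w u) (decon_w ?G)) + prepend1 k (qs2 (decon_w ?F) (decon_w v))
      - prepend1 (Suc (j + k)) (qs2 (decon_w u) (decon_w v))"
    by (simp add: decon_w_Cons qs2_linear prepend1_linear del: qs_w.simps)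
  then show ?case
    using 3 by (simp add: decon_linear decon_prepend ten_linear)
qed

lemma decon_qs: "decon (qs p q) = qs2 (decon p) (decon q)"
proof (rule qlinear_eqI [where p = p and f = "\<lambda>p. decon (qs p q)"])
  show "decon (qs (bas u) q) = qs2 (decon (bas u)) (decon q)" for u
    by (rule qlinear_eqI [where p = q and f = "\<lambda>q. decon (qs (bas u) q)"]) (simp_all add: qlin decon_qs_w)
qed (simp_all add: qlin)

section \<open>The Hopf algebra morphism from forests to words\<close>

text \<open>
  This is left multiplication by \<open>x + 2 y = 2 z - x\<close> on words without constant term, as required by
  the clause for \<open>B\<^sub>+\<close>; the value at the empty word comes from \<open>\<bullet>(y) = - y x\<close>.
\<close>

fun cocycle_w :: "nat list \<Rightarrow> qsh" where
  "cocycle_w [] = - bas [0]"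
| "cocycle_w (k # u) = smul 2 (bas (Suc k # u)) - bas (0 # k # u)"

definition cocycle :: "qsh \<Rightarrow> qsh" where
  "cocycle = lin_ext cocycle_w"

definition cocycle1 :: "qsh2 \<Rightarrow> qsh2" where
  "cocycle1 = lin_ext (\<lambda>(u, v). ten (cocycle_w u) (bas v))"

lemma cocycle_bas [simp]: "cocycle (bas u) = cocycle_w u"
  and cocycle1_bas [simp]: "cocycle1 (bas (u, v)) = ten (cocycle_w u) (bas v)"
  by (simp_all add: cocycle_def cocycle1_def)

lemma qlinear_cocycle [qlin]: "qlinear f \<Longrightarrow> qlinear (\<lambda>p. cocycle (f p))"
  by (simp add: cocycle_def qlin)

lemma qlinear_cocycle1 [qlin]: "qlinear f \<Longrightarrow> qlinear (\<lambda>p. cocycle1 (f p))"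
  by (simp add: cocycle1_def qlin)

lemma cocycle1_ten: "cocycle1 (ten p q) = ten (cocycle p) q"
proof (rule qlinear_eqI [where p = p and f = "\<lambda>p. cocycle1 (ten p q)"])
  show "cocycle1 (ten (bas u) q) = ten (cocycle (bas u)) q" for u
    by (rule qlinear_eqI [where p = q and f = "\<lambda>q. cocycle1 (ten (bas u) q)"]) (simp_all add: qlin)
qed (simp_all add: qlin)

lemma cocycle1_prepend1: "cocycle1 (prepend1 k x) = smul 2 (prepend1 (Suc k) x) - prepend1 0 (prepend1 k x)"
  by (rule qlinear_eqI_prod [where p = x and f = "\<lambda>x. cocycle1 (prepend1 k x)"])
    (simp_all add: qlin ten_linear)

text \<open>The Hochschild cocycle condition, of the same shape as the coproduct of a tree. Cutting
  right after the inserted letter \<open>0\<close> gives \<open>- [0] \<otimes> u\<close>, which is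
  the value of \<open>cocycle1\<close> at \<open>1 \<otimes> u\<close>; the value of
  \<open>cocycle_w\<close> at the empty word fits precisely.\<close>

lemma decon_cocycle: "decon (cocycle p) = ten (bas []) (cocycle p) + cocycle1 (decon p)"
proof (rule qlinear_eqI [where p = p and f = "\<lambda>p. decon (cocycle p)"])
  fix u
  show "decon (cocycle (bas u)) = ten (bas []) (cocycle (bas u)) + cocycle1 (decon (bas u))"
    by (cases u)
      (simp_all add: decon_linear decon_w_Cons ten_linear cocycle1_prepend1 prepend1_linear smul_add algebra_simps
        qlinear_add [OF qlinear_cocycle1 [OF qlinear_id']])
qed (simp_all add: qlin)

text \<open>Flattens the nested recursion through multisets of trees into cases that match how
  algebra morphisms and \<open>B_plus\<close> are computed.\<close>

lemma forest_induct [case_names empty add tree]: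
  assumes empty: "P {#}"
    and add: "\<And>t M. P {#t#} \<Longrightarrow> P M \<Longrightarrow> P (add_mset t M)"
    and tree: "\<And>M. P M \<Longrightarrow> P {#Node M#}"
  shows "P M"
proof -
  have forest: "P M" if "\<And>t. t \<in># M \<Longrightarrow> P {#t#}" for M
    using that by (induction M) (simp_all add: empty add)
  have "P {#t#}" for t
    by (induction t) (rule tree, rule forest)
  then show ?thesis by (rule forest)
qed

primrec word_tree :: "rtree \<Rightarrow> qsh" where
  "word_tree (Node M) = cocycle (qprod (image_mset word_tree M))"

definition word_forest :: "forest \<Rightarrow> qsh" where
  "word_forest M = qprod (image_mset word_tree M)"

definition word_hom :: "hopf \<Rightarrow> qsh" where
  "word_hom = lin_ext word_forest"

lemma qlinear_word_hom [qlin]: "qlinear f \<Longrightarrow> qlinear (\<lambda>p. word_hom (f p))"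
  by (simp add: word_hom_def qlin)

lemma word_forest_empty [simp]: "word_forest {#} = bas []"
  and word_forest_union: "word_forest (M + N) = qs (word_forest M) (word_forest N)"
  and word_forest_add: "word_forest (add_mset t M) = qs (word_forest {#t#}) (word_forest M)"
  and word_forest_tree: "word_forest {#Node M#} = cocycle (word_forest M)"
  and word_hom_bas [simp]: "word_hom (bas M) = word_forest M"
  by (simp_all add: word_forest_def word_hom_def)

lemma word_hom_one [simp]: "word_hom 1 = bas []"
  unfolding one_hopf by (simp del: single_one)

lemma word_hom_mult: "word_hom (f * g) = qs (word_hom f) (word_hom g)"
proof (rule qlinear_eqI [where p = f and f = "\<lambda>f. word_hom (f * g)"])
  show "word_hom (bas M * g) = qs (word_hom (bas M)) (word_hom g)" for M
    by (rule qlinear_eqI [where p = g and f = "\<lambda>g. word_hom (bas M * g)"])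
      (simp_all add: qlin mult_single word_forest_union)
qed (simp_all add: qlin)

lemma coproduct_tree: "coproduct (bas {#Node M#}) = of_forest2 {#} {#Node M#} + B_plus_id (coproduct (bas M))"
  by (simp add: coproduct_def)

lemma coproduct_add: "coproduct (bas (add_mset t M)) = coproduct (bas {#t#}) * coproduct (bas M)"
  by (simp add: coproduct_def)

lemma qlinear_coproduct [qlin]: "qlinear f \<Longrightarrow> qlinear (\<lambda>p. coproduct (f p))"
  by (simp add: coproduct_def qlin)

lemma B_plus_id_bas [simp]: "B_plus_id (of_forest2 M N) = of_forest2 {#Node M#} N"
  by (simp add: B_plus_id_def)

lemma qlinear_B_plus_id [qlin]: "qlinear f \<Longrightarrow> qlinear (\<lambda>p. B_plus_id (f p))"
  by (simp add: B_plus_id_def qlin)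

definition word_hom2 :: "hopf2 \<Rightarrow> qsh2" where
  "word_hom2 = lin_ext (\<lambda>(M, N). ten (word_forest M) (word_forest N))"

lemma word_hom2_bas [simp]: "word_hom2 (of_forest2 M N) = ten (word_forest M) (word_forest N)"
  by (simp add: word_hom2_def)

lemma qlinear_word_hom2 [qlin]: "qlinear f \<Longrightarrow> qlinear (\<lambda>p. word_hom2 (f p))"
  by (simp add: word_hom2_def qlin)

lemma word_hom2_mult: "word_hom2 (x * y) = qs2 (word_hom2 x) (word_hom2 y)"
proof (rule qlinear_eqI_prod [where p = x and f = "\<lambda>x. word_hom2 (x * y)"])
  show "word_hom2 (of_forest2 M N * y) = qs2 (word_hom2 (of_forest2 M N)) (word_hom2 y)" for M N
    by (rule qlinear_eqI_prod [where p = y and f = "\<lambda>y. word_hom2 (of_forest2 M N * y)"])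
      (simp_all add: qlin mult_single word_forest_union qs2_ten)
qed (simp_all add: qlin)

lemma word_hom2_B_plus_id: "word_hom2 (B_plus_id x) = cocycle1 (word_hom2 x)"
  by (rule qlinear_eqI_prod [where p = x and f = "\<lambda>x. word_hom2 (B_plus_id x)"])
    (simp_all add: qlin cocycle1_ten word_forest_tree B_plus_id_bas)

text \<open>An instance of the universal property of the Connes-Kreimer algebra: an algebra morphism
  taking \<open>B_plus\<close> to a cocycle respects coproducts.\<close>

lemma word_hom2_coproduct: "word_hom2 (coproduct f) = decon (word_hom f)"
proof (rule qlinear_eqI [where p = f and f = "\<lambda>f. word_hom2 (coproduct f)"])
  show "word_hom2 (coproduct (bas M)) = decon (word_hom (bas M))" for M
  proof (induction M rule: forest_induct)
    case (add t M)
    then show ?case by (simp add: coproduct_add [of t M] word_hom2_mult word_forest_add [of t M] decon_qs)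
  next
    case (tree M)
    then show ?case
      by (simp add: coproduct_tree qlinear_add [OF qlinear_word_hom2 [OF qlinear_id']] word_hom2_B_plus_id
          word_forest_tree decon_cocycle)
  next
    case empty
    have "word_hom2 1 = bas ([], [])" unfolding one_hopf2 by simp
    then show ?case by (simp add: coproduct_one)
  qed
qed (simp_all add: qlin)

text \<open>Transfer principle: a Sweedler sum over forests whose summand depends only on the words
  becomes a sum over splittings of single words. Both the Leibniz rule and the \<tau>-identity are
  obtained through it.\<close>

lemma lin_ext_coproduct_word_hom:
  "lin_ext (\<lambda>(M, N). lin_ext (\<lambda>A. lin_ext (b A) (word_forest N)) (word_forest M)) (coproduct f) =
     lin_ext (\<lambda>A. decon_sum A b) (word_hom f)"
proof -
  have "lin_ext (case_prod b) (decon_w A) = decon_sum A b" for A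
    by (simp add: decon_w_def decon_sum_hom [of "lin_ext (case_prod b)"] lin_ext_add)
  then have "lin_ext (\<lambda>A. decon_sum A b) (word_hom f) = lin_ext (case_prod b) (word_hom2 (coproduct f))"
    by (simp add: word_hom2_coproduct decon_def lin_ext_lin_ext)
  also have "\<dots> = lin_ext (\<lambda>(M, N). lin_ext (case_prod b) (ten (word_forest M) (word_forest N))) (coproduct f)"
    by (simp add: word_hom2_def lin_ext_lin_ext case_prod_unfold)
  finally show ?thesis by (simp add: lin_ext_ten)
qed

section \<open>Constant terms of words and the counit\<close>

lemma lookup_eq_zeroI:
  assumes "qlinear f" and "\<And>k. Poly_Mapping.lookup (f (bas k)) l = 0"
  shows "Poly_Mapping.lookup (f p) l = 0"
proof -
  have "f p = lin_ext (\<lambda>k. f (bas k)) p"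
    using qlinear_lin_ext_apply [OF assms(1), of bas p] by simp
  then show ?thesis by (simp add: lin_ext_def lookup_sum assms(2))
qed

lemma smul_one_inject: "smul c 1 = (smul d 1 :: 'k::monoid_add \<Rightarrow>\<^sub>0 rat) \<longleftrightarrow> c = d"
  by (metis lookup_one_zero lookup_smul mult.right_neutral)

text \<open>The constant term can be read off from the action on \<open>1\<close>, where the product
  is composition.\<close>

lemma lookup_qs: "Poly_Mapping.lookup (qs p q) [] = Poly_Mapping.lookup p [] * Poly_Mapping.lookup q []"
proof -
  have "smul (Poly_Mapping.lookup (qs p q) []) (1 :: ncpoly) = Act p (Act q 1)"
    by (simp flip: Act_one Act_qs)
  also have "\<dots> = smul (Poly_Mapping.lookup p [] * Poly_Mapping.lookup q []) 1"
    by (simp add: Act_one qlinear_smul [OF qlinear_Act(2) [OF qlinear_id']] smul_smul mult.commute)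
  finally show ?thesis by (simp add: smul_one_inject)
qed

lemma lookup_cocycle: "Poly_Mapping.lookup (cocycle p) [] = 0"
proof (rule lookup_eq_zeroI [OF qlinear_cocycle [OF qlinear_id']])
  show "Poly_Mapping.lookup (cocycle (bas k)) [] = 0" for k
    by (cases k) (simp_all add: lookup_minus lookup_single)
qed

lemma lookup_word_forest: "Poly_Mapping.lookup (word_forest M) [] = (if M = {#} then 1 else 0)"
proof (induction M rule: forest_induct)
  case (add t M)
  then show ?case by (simp add: word_forest_add [of t M] lookup_qs)
qed (simp_all add: word_forest_tree lookup_cocycle)

lemma smul_lookup_word_hom: "smul (Poly_Mapping.lookup (word_hom f) []) w = smul (counit f) w"
  unfolding counit_def
  by (rule qlinear_eqI [where p = f and f = "\<lambda>f. smul (Poly_Mapping.lookup (word_hom f) []) w"])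
    (simp_all add: qlin qlinear_compose [OF qlinear_lookup qlinear_word_hom] lookup_word_forest lookup_single when_def)

section \<open>Rooted tree maps through words\<close>

definition rtm :: "hopf \<Rightarrow> ncpoly \<Rightarrow> ncpoly" where
  "rtm f = Act (word_hom f)"

lemma rtm_mult: "rtm (f * g) w = rtm f (rtm g w)"
  by (simp add: rtm_def word_hom_mult Act_qs)

lemma qlinear_rtm [qlin]: "qlinear g \<Longrightarrow> qlinear (\<lambda>k. rtm f (g k))"
  "qlinear h \<Longrightarrow> qlinear (\<lambda>k. rtm (h k) w)"
  by (simp_all add: rtm_def qlin)

lemma rtm_leibniz: "rtm f (v * w) = sweedler (\<lambda>g h. rtm g v * rtm h w) f"
proof -
  have "Act (word_forest M) v * Act (word_forest N) w =
      lin_ext (\<lambda>A. lin_ext (\<lambda>B. act A v * act B w) (word_forest N)) (word_forest M)" for M N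
    by (simp add: Act_def lin_ext_fun_mult_left lin_ext_fun_mult_right)
  then show ?thesis
    by (simp add: sweedler_def rtm_def lin_ext_coproduct_word_hom Act_def act_mult)
qed

lemma theta_bas [simp]: "theta (bas u) = theta_w u"
  by (simp add: theta_def)

lemma Act_Y': "Act p Y = Y * theta p"
  using Act_Y [of p 1] by (simp add: Tact_one)

lemma Act_X: "Act p X = smul (Poly_Mapping.lookup p []) Z - Y * theta p"
proof -
  have "Act p Z = smul (Poly_Mapping.lookup p []) Z"
    using Act_Z [of p 1] by (simp add: Act_one smul_mult_right)
  then show ?thesis
    by (simp add: X_eq qlinear_diff [OF qlinear_Act(2) [OF qlinear_id']] Act_Y')
qed

text \<open>On nonempty words this is \<open>x + 2 y = 2 z - x\<close>. The correction concerns the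
  empty word, where the cocycle gives \<open>- x = (x + 2 y) - 2 z\<close>.\<close>

lemma theta_cocycle:
  "theta (cocycle p) = (X + 2 * Y) * theta p - smul (2 * Poly_Mapping.lookup p []) Z"
proof (rule qlinear_eqI [where p = p and f = "\<lambda>p. theta (cocycle p)"])
  fix u
  have "smul 2 q = q + q" for q :: ncpoly
    using add_smul [of 1 1 q] by simp
  then show "theta (cocycle (bas u)) = (X + 2 * Y) * theta (bas u) - smul (2 * Poly_Mapping.lookup (bas u) []) Z"
    by (cases u) (simp_all add: theta_def lin_ext_linear block_def Z_def algebra_simps mult_2 mult_2_right lookup_single)
next
  show "qlinear (\<lambda>p. (X + 2 * Y) * theta p - smul (2 * Poly_Mapping.lookup p []) Z)"
    by (simp add: qlin flip: smul_smul)
qed (simp_all add: qlin)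

lemma B_plus_bas: "B_plus (bas F) = bas {#Node F#}"
  by (simp add: B_plus_def)

lemma B_plus_one: "B_plus 1 = bas {#Node {#}#}"
  unfolding one_hopf by (rule B_plus_bas)

lemma is_rooted_tree_maps_rtm: "is_rooted_tree_maps rtm"
  unfolding is_rooted_tree_maps_def
proof (intro conjI allI ballI impI)
  show "rtm 1 = id"
    by (rule ext) (simp add: rtm_def)
  show "rtm (B_plus 1) X = Y * X" "rtm (B_plus 1) Y = - (Y * X)"
    by (simp_all add: B_plus_one rtm_def word_forest_tree Act_X Act_Y' theta_def lin_ext_linear block_def
        lookup_single)
next
  fix F :: forest and u assume u: "u \<in> {X, Y}" and F: "F \<noteq> {#}"
  \<comment> \<open>The word image of a nonempty forest has no constant term, so both letters are
    sent to left multiples of \<open>Y\<close>, where \<open>LY_inv\<close> is meaningful.\<close>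
  have Y: "rtm (bas F) Y = L Y (theta (word_forest F))" and X: "rtm (bas F) X = L Y (- theta (word_forest F))"
    by (simp_all add: rtm_def Act_X Act_Y' L_def lookup_word_forest F)
  have "rtm (B_plus (bas F)) Y = L Y (L (X + 2 * Y) (theta (word_forest F)))"
    and "rtm (B_plus (bas F)) X = L Y (L (X + 2 * Y) (- theta (word_forest F)))"
    by (simp_all add: B_plus_bas rtm_def Act_X Act_Y' L_def lookup_word_forest word_forest_tree lookup_cocycle theta_cocycle F)
  then show "rtm (B_plus (bas F)) u = L Y (L (X + 2 * Y) (LY_inv (rtm (bas F) u)))"
    using u by (auto simp: X Y LY_inv_L_Y)
qed (simp_all add: qlin rtm_mult rtm_leibniz)

section \<open>Conjugation by tau\<close>

lemma tau_Z: "tau Z = Z"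
  by (simp add: Z_def qlinear_add [OF qlinear_tau] tau_X tau_Y add.commute)

lemma tau_block: "tau (block k) = Y * Z ^ k"
proof -
  have "tau (Z ^ k) = Z ^ k"
    by (induction k) (simp_all add: tau_one tau_mult tau_Z power_commutes)
  then show ?thesis by (simp add: block_def tau_mult tau_X)
qed

text \<open>
  Peeling off the last letter of \<open>F\<close> turns all terms with nonempty \<open>Q\<close> into a shorter instance of the
  same sum, and what remains cancels against the term with empty \<open>Q\<close>.
\<close>

lemma decon_sum_act_tau_theta:
  "decon_sum F (\<lambda>P Q. act P (tau (theta_w Q) * X)) = (if F = [] then X else 0)"
proof (induction "length F" arbitrary: F rule: less_induct)
  case less
  show ?case
  proof (cases F rule: rev_cases)
    case (snoc G k)
    have "decon_sum G (\<lambda>P Q. act P (tau (theta_w (Q @ [k])) * X)) =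
        decon_sum G (\<lambda>P Q. decon_sum P (\<lambda>A B. Y * theta_w A * Z ^ k * act B (tau (theta_w Q) * X)))"
      by (rule decon_sum_cong)
        (simp add: theta_w_append tau_mult tau_block mult.assoc act_Y tact_def act_Z_power flip: decon_sum_mult_left)
    also have "\<dots> = decon_sum G (\<lambda>A B. Y * theta_w A * Z ^ k * decon_sum B (\<lambda>P Q. act P (tau (theta_w Q) * X)))"
      by (simp add: decon_sum_coassoc decon_sum_mult_left)
    also have "\<dots> = decon_sum G (\<lambda>A B. if B = [] then Y * theta_w A * Z ^ k * X else 0)"
      by (rule decon_sum_cong) (auto simp: less snoc tau_one)
    also have "\<dots> = Y * theta_w F"
      by (simp add: snoc theta_w_append block_def mult.assoc tau_one)
    finally have "decon_sum F (\<lambda>P Q. act P (tau (theta_w Q) * X)) = Y * theta_w F + act F X"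
      by (simp add: snoc decon_sum_snoc tau_one)
    also have "act F X = - (Y * theta_w F)"
      using act_X [of F 1] by (simp add: act_one tact_one snoc)
    finally show ?thesis by (simp add: snoc)
  qed (simp add: tau_one)
qed

text \<open>Nonempty words kill \<open>Z\<close>, so only the splitting with empty second part
  survives. Together with \<open>act_Z\<close> this lets conjugates by \<open>tau\<close> commute
  with left multiplication by \<open>Z\<close>.\<close>

lemma act_mult_Z: "act P (v * Z) = act P v * Z"
proof -
  have "act P (v * Z) = decon_sum P (\<lambda>A B. if B = [] then act A v * Z else 0)"
    unfolding act_mult using act_Z [of _ 1] by (intro decon_sum_cong) (simp add: act_one)
  then show ?thesis by simp
qed

text \<open>Induction on \<open>w\<close> for all \<open>F\<close> at once. \<open>tau\<close> turns
  a left factor \<open>X\<close> into a right factor \<open>Y\<close>, on which words act by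
  \<open>Y * theta_w\<close>; so the sum at \<open>X * v\<close> reduces to sums at
  \<open>v\<close>. A factor \<open>Z\<close> passes through, and \<open>Y = Z - X\<close>.\<close>

lemma decon_sum_act_tau_act_tau:
  "decon_sum F (\<lambda>P Q. act P (tau (act Q (tau w)))) = (if F = [] then w else 0)"
proof -
  define D where "D F w = decon_sum F (\<lambda>P Q. act P (tau (act Q (tau w))))" for F w
  have lin: "qlinear (D F)" for F
  proof -
    have "qlinear (\<lambda>w. decon_sum F (\<lambda>P Q. act P (tau (act Q (tau w)))))"
      by (simp add: qlin)
    then show ?thesis by (simp add: D_def [abs_def])
  qed
  have Z: "D F (Z * v) = Z * D F v" for F v
    by (simp add: D_def tau_mult tau_Z act_mult_Z act_Z decon_sum_mult_left)
  have tau_decon_sum: "tau (decon_sum F b) = decon_sum F (\<lambda>P Q. tau (b P Q))" for F b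
    by (rule decon_sum_hom) (simp add: qlinear_add [OF qlinear_tau])
  have act_decon_sum: "act P (decon_sum F b) = decon_sum F (\<lambda>A B. act P (b A B))" for P F b
    by (rule decon_sum_hom) (simp add: act_linear)
  have X: "D F (X * v) = (if F = [] then X * v else 0)" if "\<And>F. D F v = (if F = [] then v else 0)" for F v
  proof -
    have act_Y': "act B Y = Y * theta_w B" for B
      using act_Y [of B 1] by (simp add: tact_one)
    have "tau (act Q (tau (X * v))) = decon_sum Q (\<lambda>B C. tau (theta_w C) * X * tau (act B (tau v)))" for Q
      by (simp add: tau_mult tau_X act_mult act_Y' tau_decon_sum tau_Y mult.assoc)
    then have "D F (X * v) = decon_sum F (\<lambda>P Q. decon_sum Q (\<lambda>B C. act P (tau (theta_w C) * X * tau (act B (tau v)))))"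
      by (simp add: D_def act_decon_sum)
    also have "\<dots> = decon_sum F (\<lambda>N C. decon_sum N (\<lambda>P B. act P (tau (theta_w C) * X * tau (act B (tau v)))))"
      by (simp add: decon_sum_coassoc)
    also have "\<dots> = decon_sum F (\<lambda>N C. decon_sum N (\<lambda>P B. decon_sum P (\<lambda>A A'.
        act A (tau (theta_w C) * X) * act A' (tau (act B (tau v))))))"
      by (simp only: act_mult [where v = "tau (theta_w C) * X" for C])
    \<comment> \<open>Of the four consecutive pieces \<open>A\<close>, \<open>A'\<close>,
      \<open>B\<close>, \<open>C\<close>, the middle two become the splittings of \<open>M\<close>,
      and their sum is \<open>D M v\<close>. Only \<open>M = []\<close> survives, which leaves the
      sum of \<open>decon_sum_act_tau_theta\<close>.\<close>
    also have "\<dots> = decon_sum F (\<lambda>N C. decon_sum N (\<lambda>A M. act A (tau (theta_w C) * X) * D M v))"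
      by (simp add: decon_sum_coassoc D_def decon_sum_mult_left)
    also have "\<dots> = decon_sum F (\<lambda>N C. decon_sum N (\<lambda>A M. if M = [] then act A (tau (theta_w C) * X) * v else 0))"
      by (intro decon_sum_cong) (simp add: that)
    also have "\<dots> = (if F = [] then X * v else 0)"
      by (simp add: decon_sum_mult_right decon_sum_act_tau_theta)
    finally show ?thesis .
  qed
  have "\<forall>F. D F w = (if F = [] then w else 0)"
  proof (induction w rule: ncpoly_induct)
    case 1
    have "D F 1 = decon_sum F (\<lambda>P Q. if Q = [] then act P 1 else 0)" for F
      unfolding D_def by (rule decon_sum_cong) (simp add: tau_one act_one act_linear qlinear_zero [OF qlinear_tau])
    then show ?case by (simp add: act_one)
  next
    case (Y v)
    have "Y * v = Z * v - X * v" by (simp add: Z_def algebra_simps)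
    with Y show ?case by (simp add: qlinear_diff [OF lin] Z X)
  qed (simp_all add: Z qlinear_diff [OF lin] qlinear_smul [OF lin])
  then show ?thesis by (simp add: D_def)
qed

lemma rtm_tau_rtm_tau:
  "lin_ext (\<lambda>(M, N). rtm (bas M) (tau (rtm (bas N) (tau w)))) (coproduct f) = smul (counit f) w"
proof -
  have "rtm (bas M) (tau (rtm (bas N) (tau w))) =
      lin_ext (\<lambda>A. lin_ext (\<lambda>B. act A (tau (act B (tau w)))) (word_forest N)) (word_forest M)" for M N
    by (simp add: rtm_def Act_def qlinear_lin_ext_apply [OF qlinear_tau]
        qlinear_lin_ext_apply [OF qlinear_act [OF qlinear_id']])
  then show ?thesis
    by (simp add: lin_ext_coproduct_word_hom decon_sum_act_tau_act_tau lin_ext_delta [where g = "\<lambda>_. w"] smul_lookup_word_hom)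
qed

section \<open>Grading and counit\<close>

primrec tree_size :: "rtree \<Rightarrow> nat" where
  "tree_size (Node M) = Suc (\<Sum>\<^sub># (image_mset tree_size M))"

definition forest_size :: "forest \<Rightarrow> nat" where
  "forest_size M = \<Sum>\<^sub># (image_mset tree_size M)"

lemma forest_size_simps [simp]:
  "forest_size {#} = 0" "forest_size (add_mset t M) = tree_size t + forest_size M" "forest_size (M + N) = forest_size M + forest_size N"
  "tree_size (Node M) = Suc (forest_size M)"
  by (simp_all add: forest_size_def)

declare tree_size.simps [simp del]

lemma tree_size_pos [simp]: "0 < tree_size t"
  by (cases t) simp

lemma forest_size_eq_0 [simp]: "forest_size M = 0 \<longleftrightarrow> M = {#}"
  by (cases M) (simp_all add: add_is_0 less_imp_neq [OF tree_size_pos, symmetric])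

lemma keys_lin_ext: "Poly_Mapping.keys (lin_ext g p) \<subseteq> (\<Union>k\<in>Poly_Mapping.keys p. Poly_Mapping.keys (g k))"
proof
  fix l assume "l \<in> Poly_Mapping.keys (lin_ext g p)"
  then have "(\<Sum>k\<in>Poly_Mapping.keys p. Poly_Mapping.lookup p k * Poly_Mapping.lookup (g k) l) \<noteq> 0"
    by (simp add: in_keys_iff lin_ext_def lookup_sum)
  then obtain k where "k \<in> Poly_Mapping.keys p" "Poly_Mapping.lookup (g k) l \<noteq> 0"
    by (metis (no_types, lifting) mult_zero_right sum.neutral)
  then show "l \<in> (\<Union>k\<in>Poly_Mapping.keys p. Poly_Mapping.keys (g k))"
    by (auto simp: in_keys_iff)
qed

text \<open>The coproduct is graded by the number of vertices. This supplies the descent both for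
  uniqueness of the maps and for the left antipode law.\<close>

lemma forest_size_keys_coproduct:
  "(A, B) \<in> Poly_Mapping.keys (coproduct (bas M)) \<Longrightarrow> forest_size A + forest_size B = forest_size M"
proof (induction M arbitrary: A B rule: forest_induct)
  case empty
  have "coproduct (bas {#}) = bas ({#}, {#})"
    using coproduct_one unfolding one_hopf one_hopf2 .
  with empty show ?case by (simp del: single_one)
next
  case (add t M)
  have "(A, B) \<in> Poly_Mapping.keys (coproduct (bas {#t#}) * coproduct (bas M))"
    using add.prems by (simp add: coproduct_add [of t M])
  also have "\<dots> \<subseteq> {p + q |p q. p \<in> Poly_Mapping.keys (coproduct (bas {#t#})) \<and>
      q \<in> Poly_Mapping.keys (coproduct (bas M))}"
    by (rule keys_mult)
  finally obtain p q where "p \<in> Poly_Mapping.keys (coproduct (bas {#t#}))"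
      "q \<in> Poly_Mapping.keys (coproduct (bas M))" "(A, B) = p + q"
    by blast
  then show ?case
    using add.IH(1) [of "fst p" "snd p"] add.IH(2) [of "fst q" "snd q"] by (cases p; cases q) auto
next
  case (tree M)
  have "(A, B) \<in> Poly_Mapping.keys (of_forest2 {#} {#Node M#}) \<union>
      Poly_Mapping.keys (B_plus_id (coproduct (bas M)))"
    by (rule subsetD [OF keys_add]) (use tree.prems in \<open>simp add: coproduct_tree\<close>)
  moreover have "Poly_Mapping.keys (B_plus_id (coproduct (bas M))) \<subseteq>
      (\<Union>(A, B)\<in>Poly_Mapping.keys (coproduct (bas M)). {({#Node A#}, B)})"
    unfolding B_plus_id_def
    by (rule order_trans [OF keys_lin_ext]) (rule UN_mono [OF order_refl], simp split: prod.split)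
  ultimately consider "A = {#}" "B = {#Node M#}"
    | C where "A = {#Node C#}" "(C, B) \<in> Poly_Mapping.keys (coproduct (bas M))"
    by (auto simp: split_def)
  then show ?case
  proof cases
    case 2
    then show ?thesis using tree.IH [of C B] by simp
  qed simp
qed

text \<open>\<open>E\<close> is \<open>\<epsilon> \<otimes> id\<close>, an algebra morphism. It
  kills the image of \<open>B_plus_id\<close>, whose left components are trees, so from a tree
  \<open>t\<close> only \<open>1 \<otimes> t\<close> remains.\<close>

lemma coproduct_counit_left:
  "lin_ext (\<lambda>(A, B). if A = {#} then c B else 0) (coproduct f) = lin_ext c f"
proof -
  define E where "E = lin_ext (\<lambda>(A, B :: forest). if A = ({#} :: forest) then bas B else 0)"
  have lin: "qlinear E" by (simp add: E_def qlinear_lin_ext)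
  have mult: "E (x * y) = E x * E y" for x y
    by (rule multiplicative_if_multiplicative_on_basis [OF lin]) (auto simp: E_def mult_single)
  have "E (B_plus_id x) = 0" for x
    by (rule qlinear_eqI_prod [where p = x and f = "\<lambda>x. E (B_plus_id x)"]) (simp_all add: qlin E_def)
  then have "E (coproduct (bas M)) = bas M" for M
  proof (induction M rule: forest_induct)
    case empty
    have "E 1 = bas {#}" unfolding one_hopf2 E_def by simp
    then show ?case by (simp add: coproduct_one)
  next
    case (add t M)
    then show ?case by (simp add: coproduct_add [of t M] mult mult_single)
  next
    case (tree M)
    then show ?case by (simp add: coproduct_tree qlinear_add [OF lin]) (simp add: E_def)
  qed
  then have "E (coproduct f) = f"
    by (intro qlinear_eqI [where p = f and f = "\<lambda>f. E (coproduct f)"])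
      (simp_all add: qlinear_compose [OF lin] qlin)
  then have "lin_ext c f = lin_ext c (E (coproduct f))"
    by simp
  also have "\<dots> = lin_ext (\<lambda>(A, B). if A = {#} then c B else 0) (coproduct f)"
    unfolding E_def lin_ext_lin_ext
    by (rule lin_ext_cong) (auto simp: lin_ext_linear)
  finally show ?thesis by simp
qed

text \<open>Here \<open>E\<close> is \<open>id \<otimes> \<epsilon>\<close>. It kills
  \<open>1 \<otimes> t\<close> and carries \<open>B_plus_id\<close> to \<open>B_plus\<close>, so a
  tree is recovered from its branches.\<close>

lemma coproduct_counit_right:
  "lin_ext (\<lambda>(A, B). if B = {#} then c A else 0) (coproduct f) = lin_ext c f"
proof -
  define E where "E = lin_ext (\<lambda>(A :: forest, B). if B = ({#} :: forest) then bas A else 0)"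
  have lin: "qlinear E" by (simp add: E_def qlinear_lin_ext)
  have mult: "E (x * y) = E x * E y" for x y
    by (rule multiplicative_if_multiplicative_on_basis [OF lin]) (auto simp: E_def mult_single)
  have "E (B_plus_id x) = B_plus (E x)" for x
    by (rule qlinear_eqI_prod [where p = x and f = "\<lambda>x. E (B_plus_id x)"])
      (simp_all add: qlin E_def B_plus_def lin_ext_linear)
  then have "E (coproduct (bas M)) = bas M" for M
  proof (induction M rule: forest_induct)
    case empty
    have "E 1 = bas {#}" unfolding one_hopf2 E_def by simp
    then show ?case by (simp add: coproduct_one)
  next
    case (add t M)
    then show ?case by (simp add: coproduct_add [of t M] mult mult_single)
  next
    case (tree M)
    then show ?case
      by (simp add: coproduct_tree qlinear_add [OF lin] B_plus_bas) (simp add: E_def)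
  qed
  then have "E (coproduct f) = f"
    by (intro qlinear_eqI [where p = f and f = "\<lambda>f. E (coproduct f)"])
      (simp_all add: qlinear_compose [OF lin] qlin)
  then have "lin_ext c f = lin_ext c (E (coproduct f))"
    by simp
  also have "\<dots> = lin_ext (\<lambda>(A, B). if B = {#} then c A else 0) (coproduct f)"
    unfolding E_def lin_ext_lin_ext
    by (rule lin_ext_cong) (auto simp: lin_ext_linear)
  finally show ?thesis by simp
qed

section \<open>Uniqueness of the rooted tree maps\<close>

lemma is_rooted_tree_mapsD:
  assumes "is_rooted_tree_maps R"
  shows "qlinear (R f)" "qlinear (\<lambda>f. R f w)" "R 1 = id"
    "R (B_plus 1) X = Y * X" "R (B_plus 1) Y = - (Y * X)"
    "F \<noteq> {#} \<Longrightarrow> u \<in> {X, Y} \<Longrightarrow>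
       R (B_plus (bas F)) u = L Y (L (X + 2 * Y) (LY_inv (R (bas F) u)))"
    "u \<in> {X, Y} \<Longrightarrow> R (g * h) u = R g (R h u)"
    "u \<in> {X, Y} \<Longrightarrow> R f (u * w) = sweedler (\<lambda>g h. R g u * R h w) f"
  using assms unfolding is_rooted_tree_maps_def by blast+

text \<open>By the grading, each Leibniz term with nonempty first forest involves only values on
  which \<open>R\<close> and \<open>R'\<close> agree; what is left is the term
  \<open>1 \<otimes> M\<close>.\<close>

lemma rooted_tree_maps_letter_mult_diff:
  assumes R: "is_rooted_tree_maps R" and R': "is_rooted_tree_maps R'"
    and letters: "\<And>A v. forest_size A \<le> forest_size M \<Longrightarrow> v \<in> {X, Y} \<Longrightarrow> R (bas A) v = R' (bas A) v"
    and smaller: "\<And>B. forest_size B < forest_size M \<Longrightarrow> R (bas B) w = R' (bas B) w"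
    and u: "u \<in> {X, Y}"
  shows "R (bas M) (u * w) - R' (bas M) (u * w) = u * (R (bas M) w - R' (bas M) w)"
proof -
  let ?c = "\<lambda>A B. R (bas A) u * R (bas B) w - R' (bas A) u * R' (bas B) w"
  have one: "R 1 = id" "R' 1 = id"
    by (rule is_rooted_tree_mapsD [OF R] is_rooted_tree_mapsD [OF R'])+
  have "R (bas M) (u * w) = sweedler (\<lambda>g h. R g u * R h w) (bas M)"
    "R' (bas M) (u * w) = sweedler (\<lambda>g h. R' g u * R' h w) (bas M)"
    by (rule is_rooted_tree_mapsD(8) [OF R u] is_rooted_tree_mapsD(8) [OF R' u])+
  then have "R (bas M) (u * w) - R' (bas M) (u * w) = lin_ext (\<lambda>(A, B). ?c A B) (coproduct (bas M))"
    by (simp add: sweedler_def case_prod_unfold flip: lin_ext_fun_diff)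
  also have "\<dots> = lin_ext (\<lambda>(A, B). if A = {#} then ?c {#} B else 0) (coproduct (bas M))"
  proof (rule lin_ext_cong, clarify)
    fix A B assume key: "(A, B) \<in> Poly_Mapping.keys (coproduct (bas M))"
    show "?c A B = (if A = {#} then ?c {#} B else 0)"
    proof (cases "A = {#}")
      case False
      then have "forest_size A \<le> forest_size M" "forest_size B < forest_size M"
        using forest_size_keys_coproduct [OF key] by (auto simp flip: forest_size_eq_0)
      then show ?thesis using letters u smaller False by simp
    qed simp
  qed
  also have "\<dots> = ?c {#} M"
    unfolding coproduct_counit_left by simp
  finally show ?thesis
    by (simp add: one right_diff_distrib)
qed

lemma rooted_tree_maps_unique_basis:
  assumes R: "is_rooted_tree_maps R" and R': "is_rooted_tree_maps R'"
  shows "R (bas M) w = R' (bas M) w"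
proof (induction "forest_size M" arbitrary: M w rule: less_induct)
  case less
  \<comment> \<open>On letters, size \<open>M\<close> itself is within reach, as the tree and
    product clauses lead to smaller forests. The product clause uses the induction hypothesis at
    arbitrary polynomials.\<close>
  have letters: "R (bas A) u = R' (bas A) u" if A: "forest_size A \<le> forest_size M" and u: "u \<in> {X, Y}" for A u
  proof -
    consider "A = {#}" | "A = {#Node {#}#}" | F where "A = {#Node F#}" "F \<noteq> {#}"
      | t N where "A = add_mset t N" "N \<noteq> {#}"
    proof (cases A)
      case (add t N)
      then show ?thesis
        using that by (cases t; cases "N = {#}"; metis)
    qed blast
    then show ?thesis
    proof cases
      case 1
      then show ?thesis
        by (simp add: is_rooted_tree_mapsD(3) [OF R] is_rooted_tree_mapsD(3) [OF R'])
    next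
      case 2
      then have "bas A = B_plus 1" by (simp add: B_plus_one)
      then show ?thesis
        using u is_rooted_tree_mapsD(4,5) [OF R] is_rooted_tree_mapsD(4,5) [OF R'] by auto
    next
      case (3 F)
      have "R (B_plus (bas F)) u = L Y (L (X + 2 * Y) (LY_inv (R (bas F) u)))"
        "R' (B_plus (bas F)) u = L Y (L (X + 2 * Y) (LY_inv (R' (bas F) u)))"
        by (rule is_rooted_tree_mapsD(6) [OF R 3(2) u] is_rooted_tree_mapsD(6) [OF R' 3(2) u])+
      moreover have "R (bas F) u = R' (bas F) u"
        by (rule less) (use A 3 in simp)
      ultimately show ?thesis by (simp add: B_plus_bas 3)
    next
      case (4 t N)
      then have A_eq: "bas A = bas {#t#} * bas N" by (simp add: mult_single)
      have prod: "R (bas {#t#} * bas N) u = R (bas {#t#}) (R (bas N) u)"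
        "R' (bas {#t#} * bas N) u = R' (bas {#t#}) (R' (bas N) u)"
        by (rule is_rooted_tree_mapsD(7) [OF R u] is_rooted_tree_mapsD(7) [OF R' u])+
      have "0 < forest_size N" using 4(2) by (metis forest_size_eq_0 gr0I)
      then have "forest_size {#t#} < forest_size M" "forest_size N < forest_size M"
        using A 4(1) tree_size_pos [of t] by (simp_all del: tree_size_pos)
      then show ?thesis unfolding A_eq prod by (simp only: less)
    qed
  qed
  have diff: "R (bas M) (u * w) - R' (bas M) (u * w) = u * (R (bas M) w - R' (bas M) w)"
    if "u \<in> {X, Y}" for u w
    using R R' letters less that by (rule rooted_tree_maps_letter_mult_diff)
  note lin = is_rooted_tree_mapsD(1) [OF R, of "bas M"] is_rooted_tree_mapsD(1) [OF R', of "bas M"]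
  \<comment> \<open>No clause directly evaluates a map of positive degree at \<open>1\<close>.
    Writing \<open>Y = Y * 1\<close>, the difference at \<open>Y\<close>, which is 0, equals
    \<open>Y\<close> times the difference at \<open>1\<close>, and left multiplication by
    \<open>Y\<close> is injective.\<close>
  have one: "R (bas M) 1 = R' (bas M) 1"
  proof -
    have "L Y (R (bas M) 1 - R' (bas M) 1) = R (bas M) (Y * 1) - R' (bas M) (Y * 1)"
      unfolding L_def by (rule diff [symmetric]) simp
    also have "\<dots> = L Y 0"
      using letters [of M Y] by (simp add: L_def)
    finally show ?thesis by (metis injD [OF inj_L_Y] right_minus_eq)
  qed
  have mult: "R (bas M) (u * v) = R' (bas M) (u * v)" if "R (bas M) v = R' (bas M) v" "u \<in> {X, Y}" for u v
    using diff [of u v] that by simp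
  show ?case
  proof (rule qlinear_eqI_YZ [OF lin one])
    fix v assume v: "R (bas M) v = R' (bas M) v"
    then show "R (bas M) (Y * v) = R' (bas M) (Y * v)"
      by (simp add: mult)
    then show "R (bas M) (Z * v) = R' (bas M) (Z * v)"
      using mult [OF v, of X] by (simp add: Z_def distrib_right qlinear_add [OF lin(1)] qlinear_add [OF lin(2)])
  qed
qed

lemma rooted_tree_map_eq: "rooted_tree_map = rtm"
  unfolding rooted_tree_map_def
proof (rule the_equality)
  fix R assume R: "is_rooted_tree_maps R"
  show "R = rtm"
  proof (intro ext)
    fix f w
    show "R f w = rtm f w"
      using is_rooted_tree_mapsD(2) [OF R] is_rooted_tree_mapsD(2) [OF is_rooted_tree_maps_rtm]
        rooted_tree_maps_unique_basis [OF R is_rooted_tree_maps_rtm]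
      by (rule qlinear_eqI [where p = f and f = "\<lambda>f. R f w"])
  qed
qed (rule is_rooted_tree_maps_rtm)

section \<open>Coassociativity\<close>

lemma coassoc_embed_mult:
  fixes x y :: hopf2 and G H :: forest
  shows "lin_ext (\<lambda>(A, B). bas (A, B, G + H)) (x * y) =
    lin_ext (\<lambda>(A, B). bas (A, B, G)) x * lin_ext (\<lambda>(A, B). bas (A, B, H)) y"
    "lin_ext (\<lambda>(A, B). bas (G + H, A, B)) (x * y) =
    lin_ext (\<lambda>(A, B). bas (G, A, B)) x * lin_ext (\<lambda>(A, B). bas (H, A, B)) y"
proof -
  have 1: "f (x * y) = g x * h y"
    if lin: "qlinear f" "qlinear g" "qlinear h"
      and basis: "\<And>A B C D. f (bas (A + C, B + D)) = g (bas (A, B)) * h (bas (C, D))"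
    for f g h :: "hopf2 \<Rightarrow> ((forest \<times> forest \<times> forest) \<Rightarrow>\<^sub>0 rat)"
  proof (rule qlinear_eqI_prod [where p = x and f = "\<lambda>x. f (x * y)"])
    show "f (of_forest2 A B * y) = g (of_forest2 A B) * h y" for A B
      by (rule qlinear_eqI_prod [where p = y and f = "\<lambda>y. f (of_forest2 A B * y)"])
        (simp_all add: qlin lin qlinear_compose [OF lin(1)] mult_single basis)
  qed (simp_all add: qlin lin qlinear_compose [OF lin(1)])
  show "lin_ext (\<lambda>(A, B). bas (A, B, G + H)) (x * y) =
    lin_ext (\<lambda>(A, B). bas (A, B, G)) x * lin_ext (\<lambda>(A, B). bas (A, B, H)) y"
    "lin_ext (\<lambda>(A, B). bas (G + H, A, B)) (x * y) =
    lin_ext (\<lambda>(A, B). bas (G, A, B)) x * lin_ext (\<lambda>(A, B). bas (H, A, B)) y"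
    by (rule 1; simp add: qlinear_lin_ext mult_single)+
qed

text \<open>\<open>DL\<close> and \<open>DR\<close> are \<open>\<Delta> \<otimes> id\<close> and
  \<open>id \<otimes> \<Delta>\<close>, both algebra morphisms; \<open>B3\<close> applies
  \<open>B_plus\<close> to the first factor and \<open>k\<close> is \<open>1 \<otimes> -\<close>. On
  a tree the \<open>k\<close> term arises once on each side: from splitting the grafted left factor,
  and from splitting \<open>t\<close> in \<open>1 \<otimes> t\<close>.\<close>

lemma coproduct_coassoc:
  "lin_ext (\<lambda>(F, G). lin_ext (\<lambda>(A, B). c A B G) (coproduct (bas F))) (coproduct f) =
   lin_ext (\<lambda>(F, G). lin_ext (\<lambda>(A, B). c F A B) (coproduct (bas G))) (coproduct f)"
proof -
  define DL DR :: "hopf2 \<Rightarrow> ((forest \<times> forest \<times> forest) \<Rightarrow>\<^sub>0 rat)"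
    where "DL = lin_ext (\<lambda>(F, G). lin_ext (\<lambda>(A, B). bas (A, B, G)) (coproduct (bas F)))"
      and "DR = lin_ext (\<lambda>(F, G). lin_ext (\<lambda>(A, B). bas (F, A, B)) (coproduct (bas G)))"
  define B3 :: "((forest \<times> forest \<times> forest) \<Rightarrow>\<^sub>0 rat) \<Rightarrow> ((forest \<times> forest \<times> forest) \<Rightarrow>\<^sub>0 rat)"
    where "B3 = lin_ext (\<lambda>(A, B, C). bas ({#Node A#}, B, C))"
  define k :: "hopf2 \<Rightarrow> ((forest \<times> forest \<times> forest) \<Rightarrow>\<^sub>0 rat)"
    where "k = lin_ext (\<lambda>(A, B). bas ({#}, A, B))"
  have lin: "qlinear DL" "qlinear DR" "qlinear B3" "qlinear k"
    by (simp_all add: DL_def DR_def B3_def k_def qlinear_lin_ext)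
  note linear = lin [THEN qlinear_add]
  note lin' = lin [THEN qlinear_compose]
  have cop_mult: "coproduct (bas (F + G)) = coproduct (bas F) * coproduct (bas G)" for F G
    by (simp add: mult_single flip: coproduct_mult)
  have multL: "DL (x * y) = DL x * DL y" and multR: "DR (x * y) = DR x * DR y" for x y
    by (rule multiplicative_if_multiplicative_on_basis;
        (clarsimp simp: lin)?; auto simp: DL_def DR_def cop_mult coassoc_embed_mult)+
  have treeL: "DL (B_plus_id x) = k (B_plus_id x) + B3 (DL x)" for x
  proof (rule qlinear_eqI_prod [where p = x and f = "\<lambda>x. DL (B_plus_id x)"])
    fix F G
    have "lin_ext (\<lambda>(A, B). bas (A, B, G)) (B_plus_id y) = B3 (lin_ext (\<lambda>(A, B). bas (A, B, G)) y)" for y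
      by (rule qlinear_eqI_prod [where p = y and f = "\<lambda>y. lin_ext (\<lambda>(A, B). bas (A, B, G)) (B_plus_id y)"])
        (simp_all add: qlin lin', simp add: B3_def)
    then show "DL (B_plus_id (of_forest2 F G)) = k (B_plus_id (of_forest2 F G)) + B3 (DL (of_forest2 F G))"
      by (simp add: DL_def k_def coproduct_tree lin_ext_add)
  qed (simp_all add: qlin lin')
  have treeR: "DR (B_plus_id x) = B3 (DR x)" for x
  proof (rule qlinear_eqI_prod [where p = x and f = "\<lambda>x. DR (B_plus_id x)"])
    fix F G
    have "lin_ext (\<lambda>(A, B). bas ({#Node F#}, A, B)) y = B3 (lin_ext (\<lambda>(A, B). bas (F, A, B)) y)" for y
      by (rule qlinear_eqI_prod [where p = y and f = "lin_ext (\<lambda>(A, B). bas ({#Node F#}, A, B))"])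
        (simp_all add: qlin lin', simp add: B3_def)
    then show "DR (B_plus_id (of_forest2 F G)) = B3 (DR (of_forest2 F G))"
      by (simp add: DR_def)
  qed (simp_all add: qlin lin')
  have "DL (coproduct (bas M)) = DR (coproduct (bas M))" for M
  proof (induction M rule: forest_induct)
    case empty
    have cop: "coproduct (bas {#}) = bas ({#}, {#})"
      using coproduct_one unfolding one_hopf one_hopf2 .
    have "DL 1 = bas ({#}, {#}, {#})" "DR 1 = bas ({#}, {#}, {#})"
      unfolding one_hopf2 DL_def DR_def lin_ext_single prod.case cop by (rule refl)+
    then show ?case by (simp add: coproduct_one)
  next
    case (add t M)
    then show ?case by (simp add: coproduct_add [of t M] multL multR)
  next
    case (tree M)
    have "DL (of_forest2 {#} {#Node M#}) = bas ({#}, {#}, {#Node M#})"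
      using coproduct_one unfolding one_hopf one_hopf2 DL_def lin_ext_single prod.case by simp
    moreover have "DR (of_forest2 {#} {#Node M#}) =
        bas ({#}, {#}, {#Node M#}) + k (B_plus_id (coproduct (bas M)))"
      by (simp add: DR_def k_def coproduct_tree lin_ext_add)
    ultimately show ?case using tree by (simp add: coproduct_tree linear treeL treeR)
  qed
  then have eq: "DL (coproduct f) = DR (coproduct f)"
    by (intro qlinear_eqI [where p = f and f = "\<lambda>f. DL (coproduct f)"]) (simp_all add: qlin lin')
  have "lin_ext (\<lambda>(A, B, C). c A B C) (DL x) =
      lin_ext (\<lambda>(F, G). lin_ext (\<lambda>(A, B). c A B G) (coproduct (bas F))) x" for x
    by (simp add: DL_def lin_ext_lin_ext case_prod_unfold)
  moreover have "lin_ext (\<lambda>(A, B, C). c A B C) (DR x) =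
      lin_ext (\<lambda>(F, G). lin_ext (\<lambda>(A, B). c F A B) (coproduct (bas G))) x" for x
    by (simp add: DR_def lin_ext_lin_ext case_prod_unfold)
  ultimately show ?thesis using eq by metis
qed

text \<open>\<open>a = a * (b * c) = (a * b) * c = c\<close> for the convolution product. With
  operators as values it covers the antipode, through left multiplications, as well as the rooted
  tree maps.\<close>

lemma convolution_inverse_unique:
  fixes a b c :: "forest \<Rightarrow> ('v \<Rightarrow>\<^sub>0 rat) \<Rightarrow> ('v \<Rightarrow>\<^sub>0 rat)"
  assumes lin: "\<And>M. qlinear (a M)"
    and ab: "\<And>M w. lin_ext (\<lambda>(A, B). a A (b B w)) (coproduct (bas M)) = (if M = {#} then w else 0)"
    and bc: "\<And>M w. lin_ext (\<lambda>(A, B). b A (c B w)) (coproduct (bas M)) = (if M = {#} then w else 0)"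
  shows "a M w = c M w"
proof -
  have "a M w = lin_ext (\<lambda>(F, G). if G = {#} then a F w else 0) (coproduct (bas M))"
    unfolding coproduct_counit_right by simp
  also have "\<dots> = lin_ext (\<lambda>(F, G). a F (lin_ext (\<lambda>(A, B). b A (c B w)) (coproduct (bas G)))) (coproduct (bas M))"
    by (rule lin_ext_cong) (auto simp: bc qlinear_zero [OF lin])
  also have "\<dots> = lin_ext (\<lambda>(F, G). lin_ext (\<lambda>(A, B). a F (b A (c B w))) (coproduct (bas G))) (coproduct (bas M))"
    by (simp add: qlinear_lin_ext_apply [OF lin] case_prod_unfold)
  also have "\<dots> = lin_ext (\<lambda>(F, G). lin_ext (\<lambda>(A, B). a A (b B (c G w))) (coproduct (bas F))) (coproduct (bas M))"
    by (rule coproduct_coassoc [symmetric])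
  also have "\<dots> = lin_ext (\<lambda>(F, G). if F = {#} then c G w else 0) (coproduct (bas M))"
    by (simp add: ab)
  also have "\<dots> = c M w"
    unfolding coproduct_counit_left by simp
  finally show ?thesis .
qed

section \<open>The antipode\<close>

definition hopf_mult :: "hopf2 \<Rightarrow> hopf" where
  "hopf_mult = lin_ext (\<lambda>(A, B). bas (A + B))"

definition one_tensor :: "hopf \<Rightarrow> hopf2" where
  "one_tensor = lin_ext (\<lambda>B. bas ({#}, B))"

text \<open>
  The antipode of a tree involves antipodes of subforests that are not branches of it. Computing
  \<open>(id \<otimes> S) \<Delta>\<close> instead of \<open>S\<close> makes the recursion structural.
\<close>

primrec id_antipode_tree :: "rtree \<Rightarrow> hopf2" where
  "id_antipode_tree (Node M) =
     B_plus_id (\<Prod>\<^sub># (image_mset id_antipode_tree M)) - one_tensor (hopf_mult (B_plus_id (\<Prod>\<^sub># (image_mset id_antipode_tree M))))"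

text \<open>Solves \<open>\<Sum> t' S(t'') = 0\<close> for \<open>S(t)\<close>, which enters through
  the term \<open>1 \<otimes> t\<close>.\<close>

primrec antipode_tree :: "rtree \<Rightarrow> hopf" where
  "antipode_tree (Node M) = - hopf_mult (B_plus_id (\<Prod>\<^sub># (image_mset id_antipode_tree M)))"

definition antipode_forest :: "forest \<Rightarrow> hopf" where
  "antipode_forest M = \<Prod>\<^sub># (image_mset antipode_tree M)"

lemma antipode_forest_simps [simp]: "antipode_forest {#} = 1" "antipode_forest (add_mset t M) = antipode_tree t * antipode_forest M" "antipode_forest (M + N) = antipode_forest M * antipode_forest N"
  by (simp_all add: antipode_forest_def)

lemma qlinear_hopf_mult [qlin]: "qlinear f \<Longrightarrow> qlinear (\<lambda>p. hopf_mult (f p))"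
  and qlinear_one_tensor [qlin]: "qlinear g \<Longrightarrow> qlinear (\<lambda>p. one_tensor (g p))"
  by (simp_all add: hopf_mult_def one_tensor_def qlin)

lemma ten_mult: "ten p q * ten r s = ten (p * r) (q * s)"
  for p r :: "'k::monoid_add \<Rightarrow>\<^sub>0 rat" and q s :: "'l::monoid_add \<Rightarrow>\<^sub>0 rat"
proof (rule qlinear_eqI [where p = p and f = "\<lambda>p. ten p q * ten r s"])
  fix a
  show "ten (bas a) q * ten r s = ten (bas a * r) (q * s)"
  proof (rule qlinear_eqI [where p = q and f = "\<lambda>q. ten (bas a) q * ten r s"])
    fix b
    show "ten (bas a) (bas b) * ten r s = ten (bas a * r) (bas b * s)"
    proof (rule qlinear_eqI [where p = r and f = "\<lambda>r. ten (bas a) (bas b) * ten r s"])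
      fix c
      show "ten (bas a) (bas b) * ten (bas c) s = ten (bas a * bas c) (bas b * s)"
        by (rule qlinear_eqI [where p = s and f = "\<lambda>s. ten (bas a) (bas b) * ten (bas c) s"])
          (simp_all add: qlin mult_single)
    qed (simp_all add: qlin)
  qed (simp_all add: qlin)
qed (simp_all add: qlin)

lemma hopf_mult_mult: "hopf_mult (x * y) = hopf_mult x * hopf_mult y"
  by (rule multiplicative_if_multiplicative_on_basis)
    (auto simp: hopf_mult_def qlinear_lin_ext mult_single ac_simps)

lemma hopf_mult_ten: "hopf_mult (ten p q) = p * q"
proof (rule qlinear_eqI [where p = p and f = "\<lambda>p. hopf_mult (ten p q)"])
  show "hopf_mult (ten (bas a) q) = bas a * q" for a
    by (rule qlinear_eqI [where p = q and f = "\<lambda>q. hopf_mult (ten (bas a) q)"])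
      (simp_all add: qlin, simp add: hopf_mult_def mult_single)
qed (simp_all add: qlin)

lemma one_tensor_eq_ten: "one_tensor p = ten (bas {#}) p"
  by (rule qlinear_eqI [where p = p and f = one_tensor]) (simp_all add: one_tensor_def qlinear_lin_ext qlin del: single_one)

definition id_tensor_antipode :: "hopf2 \<Rightarrow> hopf2" where
  "id_tensor_antipode = lin_ext (\<lambda>(A, B). ten (bas A) (antipode_forest B))"

lemma id_tensor_antipode_coproduct: "id_tensor_antipode (coproduct (bas M)) = \<Prod>\<^sub># (image_mset id_antipode_tree M)"
proof -
  have lin: "qlinear id_tensor_antipode" by (simp add: id_tensor_antipode_def qlinear_lin_ext)
  have mult: "id_tensor_antipode (x * y) = id_tensor_antipode x * id_tensor_antipode y" for x y
    by (rule multiplicative_if_multiplicative_on_basis [OF lin])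
      (auto simp: id_tensor_antipode_def ten_mult mult_single)
  have B_plus_id_ten: "B_plus_id (ten (bas A) q) = ten (bas {#Node A#}) q" for A q
    by (rule qlinear_eqI [where p = q and f = "\<lambda>q. B_plus_id (ten (bas A) q)"]) (simp_all add: qlin)
  have B: "id_tensor_antipode (B_plus_id x) = B_plus_id (id_tensor_antipode x)" for x
    by (rule qlinear_eqI_prod [where p = x and f = "\<lambda>x. id_tensor_antipode (B_plus_id x)"])
      (simp_all add: qlin lin qlinear_compose [OF lin], simp add: id_tensor_antipode_def B_plus_id_ten)
  show ?thesis
  proof (induction M rule: forest_induct)
    case empty
    have "id_tensor_antipode 1 = ten (bas {#}) (bas {#})"
      unfolding one_hopf2 id_tensor_antipode_def lin_ext_single prod.case antipode_forest_simps one_hopf by (rule refl)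
    also have "\<dots> = 1" unfolding ten_bas one_hopf2 ..
    finally show ?case by (simp add: coproduct_one)
  next
    case (add t M)
    then show ?case by (simp add: coproduct_add [of t M] mult)
  next
    case (tree M)
    have "id_tensor_antipode (of_forest2 {#} {#Node M#}) = one_tensor (antipode_tree (Node M))"
      unfolding id_tensor_antipode_def lin_ext_single one_tensor_eq_ten by simp
    with tree show ?case
      by (simp add: coproduct_tree qlinear_add [OF lin] B qlinear_uminus [OF qlinear_one_tensor [OF qlinear_id']])
  qed
qed

lemma hopf_mult_id_tensor_antipode: "hopf_mult (id_tensor_antipode x) = lin_ext (\<lambda>(A, B). bas A * antipode_forest B) x"
  unfolding id_tensor_antipode_def qlinear_lin_ext_apply [OF qlinear_hopf_mult [OF qlinear_id']]
  by (simp add: case_prod_unfold hopf_mult_ten)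

text \<open>Multiplication kills \<open>id_antipode_tree t\<close> by construction, and it is an
  algebra morphism because the Hopf algebra is commutative.\<close>

lemma antipode_forest_right_inverse:
  "lin_ext (\<lambda>(A, B). bas A * antipode_forest B) (coproduct (bas M)) = (if M = {#} then 1 else 0)"
proof -
  have "hopf_mult 1 = bas ({#} + {#})"
    unfolding one_hopf2 hopf_mult_def lin_ext_single prod.case by (rule refl)
  then have one: "hopf_mult 1 = 1" by simp
  have "hopf_mult (one_tensor p) = p" for p
    by (simp add: one_tensor_eq_ten hopf_mult_ten)
  then have tree: "hopf_mult (id_antipode_tree t) = 0" for t
    by (cases t) (simp add: qlinear_diff [OF qlinear_hopf_mult [OF qlinear_id']])
  show ?thesis
    unfolding hopf_mult_id_tensor_antipode [symmetric] id_tensor_antipode_coproduct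
    by (cases M) (simp_all add: one hopf_mult_mult tree)
qed

lemma antipode_forest_tree:
  "antipode_forest {#Node M#} = - lin_ext (\<lambda>(A, B). bas {#Node A#} * antipode_forest B) (coproduct (bas M))"
proof -
  have "hopf_mult (B_plus_id (ten (bas A) q)) = bas {#Node A#} * q" for A q
    by (rule qlinear_eqI [where p = q and f = "\<lambda>q. hopf_mult (B_plus_id (ten (bas A) q))"])
      (simp_all add: qlin, simp add: hopf_mult_def mult_single)
  then have "hopf_mult (B_plus_id (id_tensor_antipode x)) = lin_ext (\<lambda>(A, B). bas {#Node A#} * antipode_forest B) x" for x
    unfolding id_tensor_antipode_def qlinear_lin_ext_apply [OF qlinear_hopf_mult [OF qlinear_B_plus_id [OF qlinear_id']]]
    by (simp add: case_prod_unfold)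
  then show ?thesis by (simp flip: id_tensor_antipode_coproduct)
qed

text \<open>Not built into the recursion, hence induction on size. For a tree, inserting the
  recursion for \<open>S\<close> and using coassociativity moves the same convolution onto smaller
  right factors; it collapses to minus the tree and cancels the contribution of
  \<open>1 \<otimes> t\<close>. Products rely on commutativity.\<close>

lemma antipode_forest_left_inverse:
  "lin_ext (\<lambda>(A, B). antipode_forest A * bas B) (coproduct (bas M)) = (if M = {#} then 1 else 0)"
proof (induction "forest_size M" arbitrary: M rule: less_induct)
  case less
  define K where "K = lin_ext (\<lambda>(A, B). antipode_forest A * bas B)"
  have lin: "qlinear K" by (simp add: K_def qlinear_lin_ext)
  have mult: "K (x * y) = K x * K y" for x y
  proof (rule multiplicative_if_multiplicative_on_basis [OF lin], clarify)
    fix A B C D :: forest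
    have "bas (B + D) = bas B * (bas D :: hopf)" by (simp add: mult_single)
    then show "K (bas ((A, B) + (C, D))) = K (bas (A, B)) * K (bas (C, D))"
      by (simp add: K_def ac_simps)
  qed
  have IH: "K (coproduct (bas N)) = (if N = {#} then 1 else 0)" if "forest_size N < forest_size M" for N
    unfolding K_def using that by (rule less)
  consider "M = {#}" | F where "M = {#Node F#}" | t N where "M = add_mset t N" "N \<noteq> {#}"
    by (metis multiset_cases rtree.exhaust)
  then have "K (coproduct (bas M)) = (if M = {#} then 1 else 0)"
  proof cases
    case 1
    have "K 1 = 1 * bas {#}"
      unfolding one_hopf2 K_def lin_ext_single prod.case antipode_forest_simps by (rule refl)
    with 1 show ?thesis by (simp add: coproduct_one)
  next
    case (2 F)
    have "K (B_plus_id x) = lin_ext (\<lambda>(A, B). antipode_forest {#Node A#} * bas B) x" for x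
      by (rule qlinear_eqI_prod [where p = x and f = "\<lambda>x. K (B_plus_id x)"])
        (simp_all add: qlin lin qlinear_compose [OF lin], simp add: K_def)
    then have "K (B_plus_id (coproduct (bas F))) =
        - lin_ext (\<lambda>(A, B). lin_ext (\<lambda>(C, D). bas {#Node C#} * (antipode_forest D * bas B)) (coproduct (bas A))) (coproduct (bas F))"
      by (simp add: antipode_forest_tree qlinear_lin_ext_apply [OF qlinear_mult_right] case_prod_unfold mult.assoc
          qlinear_lin_ext_apply [OF qlinear_uminus' [OF qlinear_id']] del: antipode_forest_simps)
    also have "\<dots> = - lin_ext (\<lambda>(C, B). lin_ext (\<lambda>(D, E). bas {#Node C#} * (antipode_forest D * bas E)) (coproduct (bas B))) (coproduct (bas F))"
      by (simp only: coproduct_coassoc)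
    also have "\<dots> = - lin_ext (\<lambda>(C, B). bas {#Node C#} * K (coproduct (bas B))) (coproduct (bas F))"
      by (simp add: K_def qlinear_lin_ext_apply [OF qlinear_mult_left] case_prod_unfold)
    also have "lin_ext (\<lambda>(C, B). bas {#Node C#} * K (coproduct (bas B))) (coproduct (bas F)) =
        lin_ext (\<lambda>(C, B). if B = {#} then bas {#Node C#} else 0) (coproduct (bas F))"
    proof (rule lin_ext_cong, clarify)
      fix C B assume "(C, B) \<in> Poly_Mapping.keys (coproduct (bas F))"
      then have "forest_size B < forest_size M" using forest_size_keys_coproduct 2 by fastforce
      then show "bas {#Node C#} * K (coproduct (bas B)) = (if B = {#} then bas {#Node C#} else 0)"
        by (simp add: IH)
    qed
    also have "\<dots> = bas {#Node F#}"
      unfolding coproduct_counit_right by simp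
    finally have "K (B_plus_id (coproduct (bas F))) = - bas {#Node F#}" .
    moreover have "K (of_forest2 {#} {#Node F#}) = bas {#Node F#}"
      by (simp add: K_def)
    ultimately show ?thesis by (simp add: 2 coproduct_tree qlinear_add [OF lin])
  next
    case (3 t N)
    then have "forest_size {#t#} < forest_size M" "forest_size N < forest_size M"
      using forest_size_eq_0 [of N] tree_size_pos [of t] by (simp_all del: tree_size_pos forest_size_eq_0)
    with 3 show ?thesis by (simp add: coproduct_add [of t N] mult IH)
  qed
  then show ?case by (simp add: K_def)
qed

lemma sweedler_eq_counitI:
  assumes "\<And>M. lin_ext (\<lambda>(A, B). b (bas A) (bas B)) (coproduct (bas M)) = (if M = {#} then 1 else 0)"
  shows "sweedler b f = smul (counit f) 1"
  unfolding sweedler_def counit_def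
  by (rule qlinear_eqI [where p = f and f = "\<lambda>f. lin_ext (\<lambda>(A, B). b (bas A) (bas B)) (coproduct f)"])
    (simp_all add: qlin assms lookup_single when_def)

lemma is_antipode_antipode_forest: "is_antipode (lin_ext antipode_forest)"
  unfolding is_antipode_def
  by (intro conjI allI qlinear_lin_ext sweedler_eq_counitI)
    (simp_all add: antipode_forest_left_inverse antipode_forest_right_inverse)

text \<open>Any antipode is a left convolution inverse of the identity and so equals the right
  inverse constructed above; elements are compared through left multiplication applied to
  \<open>1\<close>.\<close>

lemma antipode_eq: "antipode = lin_ext antipode_forest"
  unfolding antipode_def
proof (rule the_equality)
  fix S assume S: "is_antipode S"
  then have lin: "qlinear S" by (simp add: is_antipode_def)
  have left: "lin_ext (\<lambda>(A, B). S (bas A) * bas B) (coproduct (bas M)) = (if M = {#} then 1 else 0)" for M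
    using S unfolding is_antipode_def sweedler_def counit_def
    by (auto simp: lookup_single when_def)
  have "S (bas M) * 1 = antipode_forest M * 1" for M
  proof (rule convolution_inverse_unique [where a = "\<lambda>M p. S (bas M) * p" and b = "\<lambda>M p. bas M * p"
        and c = "\<lambda>M p. antipode_forest M * p"])
    fix N and w :: hopf
    show "lin_ext (\<lambda>(A, B). S (bas A) * (bas B * w)) (coproduct (bas N)) = (if N = {#} then w else 0)"
      using arg_cong [OF left [of N], of "\<lambda>p. p * w"]
      by (simp add: case_prod_unfold mult.assoc qlinear_lin_ext_apply [OF qlinear_mult_right])
    show "lin_ext (\<lambda>(A, B). bas A * (antipode_forest B * w)) (coproduct (bas N)) = (if N = {#} then w else 0)"
      using arg_cong [OF antipode_forest_right_inverse [of N], of "\<lambda>p. p * w"]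
      by (simp add: case_prod_unfold mult.assoc qlinear_lin_ext_apply [OF qlinear_mult_right])
  qed (simp add: qlin)
  then show "S = lin_ext antipode_forest"
    by (intro ext) (rule qlinear_eqI [OF lin qlinear_lin_ext], simp)
qed (rule is_antipode_antipode_forest)

section \<open>Conjugation by tau is the antipode\<close>

theorem theorem1p4:
  fixes f :: hopf
  shows "rooted_tree_map (antipode f) = tau \<circ> rooted_tree_map f \<circ> tau"
proof
  fix w
  have basis: "rtm (antipode_forest M) w = tau (rtm (bas M) (tau w))" for M
  proof (rule convolution_inverse_unique [where a = "\<lambda>M. rtm (antipode_forest M)" and b = "\<lambda>M. rtm (bas M)"
        and c = "\<lambda>M w. tau (rtm (bas M) (tau w))"])
    fix N w
    have "lin_ext (\<lambda>(A, B). rtm (antipode_forest A) (rtm (bas B) w)) (coproduct (bas N)) =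
        rtm (lin_ext (\<lambda>(A, B). antipode_forest A * bas B) (coproduct (bas N))) w"
      by (simp add: qlinear_lin_ext_apply [OF qlinear_rtm(2) [OF qlinear_id']] case_prod_unfold rtm_mult)
    then show "lin_ext (\<lambda>(A, B). rtm (antipode_forest A) (rtm (bas B) w)) (coproduct (bas N)) = (if N = {#} then w else 0)"
      by (simp add: antipode_forest_left_inverse rtm_def qlinear_zero [OF qlinear_word_hom [OF qlinear_id']] Act_def)
        (simp add: lin_ext_def)
    show "lin_ext (\<lambda>(A, B). rtm (bas A) (tau (rtm (bas B) (tau w)))) (coproduct (bas N)) =
        (if N = {#} then w else 0)"
      by (simp add: rtm_tau_rtm_tau counit_def lookup_single)
  qed (use qlinear_rtm(1) [OF qlinear_id'] in simp)
  have "rtm (lin_ext antipode_forest f) w = tau (rtm f (tau w))"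
    by (rule qlinear_eqI [where p = f and f = "\<lambda>f. rtm (lin_ext antipode_forest f) w"]) (simp_all add: qlin basis)
  then show "rooted_tree_map (antipode f) w = (tau \<circ> rooted_tree_map f \<circ> tau) w"
    by (simp add: rooted_tree_map_eq antipode_eq)
qed

end
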